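(* Let $p\in(1,\infty)$, $X\in\mathfrak A_p$, $\theta\in[0,p)$, $S\in\mathcal{LCR}_\theta(X)$ closed, and $\{\mathfrak m_k\}\in\mathfrak M_\theta(S)$ with parameter $\epsilon\in(0,\frac1{10}]$. Let $c\ge1$. Then there is $C>0$ such that $\operatorname{BSN}^1_{p,c}(f)\le C\operatorname{CN}_p(f)$ for all $f\in L^1_{loc}(\{\mathfrak m_k\})$. Furthermore, for each $\delta\in(0,\frac1{4c}]$ there is $C_\delta>0$ such that for all $f\in L^1_{loc}(\{\mathfrak m_k\})$, $$\big|\operatorname{BSN}^\delta_{p,c}(f)-\|f\|_{L^p(\mathfrak m_0)}\big|\le C_\delta\,\|f^\sharp\|_{L^p(U_{(c+1)\delta}(S),\mu)},$$ where $U_t(S)=\{x\in X:\operatorname{dist}(x,S)<t\}$.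
   Context: A metric measure space is a triple $X=(X,d,\mu)$ with $(X,d)$ a complete separable metric space and $\mu$ a Borel regular measure with $0<\mu(B)<\infty$ for every ball $B$ and $\operatorname{supp}\mu=X$. All balls are closed: $B_r(x)=\{y:d(x,y)\le r\}$; $\lambda B_r(x)=B_{\lambda r}(x)$, $r(B)$ is the radius. A measure on $X$ means a nonzero Borel regular locally finite (outer) measure. $\mu$ is uniformly locally doubling if for every $R>0$, $\sup_{r\in(0,R]}\sup_x\mu(B_{2r}(x))/\mu(B_r(x))<\infty$. $\operatorname{lip}f(x)=\limsup_{y\to x}|f(y)-f(x)|/d(x,y)$ at accumulation points and $0$ otherwise. For a measure $\mathfrak m$ and Borel $G$ with $0<\mathfrak m(G)<\infty$, $\mathcal E_{\mathfrak m}(f,G)=\inf_{c\in\mathbb R}\frac1{\mathfrak m(G)}\int_G|f-c|d\mathfrak m$. $X\in\mathfrak A_q$ if $\mu$ is uniformly locally doubling and for every $R>0$ there are $C>0,\lambda\ge1$ with $\mathcal E_\mu(f,B_r(x))\le Cr(\frac1{\mu(B_{\lambda r}(x))}\int_{B_{\lambda r}(x)}(\operatorname{lip}f)^qd\mu)^{1/q}$ for all Lipschitz $f$, $x$, $r\in(0,R]$. For $\theta\ge0$: $\mathcal H_{\theta,\delta}(E)=\inf\{\sum_i\mu(B_{r_i}(x_i))/r_i^\theta:E\subset\bigcup_iB_{r_i}(x_i),\ r_i<\delta\}$. $S\in\mathcal{LCR}_\theta(X)$ if there is $\lambda>0$ with $\mathcal H_{\theta,r}(B_r(x)\cap S)\ge\lambda\mu(B_r(x))/r^\theta$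 for all $x\in S$, $r\in(0,1]$. $\{\mathfrak m_k\}_{k=0}^\infty\in\mathfrak M_\theta(S)$ (parameter $\epsilon$) means: (M1) $\operatorname{supp}\mathfrak m_k=S$; (M2) $\exists C_1$: $\mathfrak m_k(B_r(x))\le C_1\mu(B_r(x))/r^\theta$ for all $k$, $x\in X$, $r\in(0,\epsilon^k]$; (M3) $\exists C_2$: $\mathfrak m_k(B_r(x))\ge C_2\mu(B_r(x))/r^\theta$ for all $k$, $x\in S$, $r\in[\epsilon^k,1]$; (M4) $\mathfrak m_k=w_k\mathfrak m_0$, $w_k\in L^\infty(\mathfrak m_0)$, $\exists C_3$: $\epsilon^{\theta j}/C_3\le w_k/w_{k+j}\le C_3$ $\mathfrak m_0$-a.e. on $S$ for all $k,j$. $L^1_{loc}(\{\mathfrak m_k\})=\bigcap_kL^1_{loc}(\mathfrak m_k)$. For $r>0$, $k(r)=\max\{k\in\mathbb Z:r\le\epsilon^k\}$; $k(B)=k(r(B))$. $\widetilde{\mathcal E}_{\mathfrak m}(f,B_r(x))=\mathcal E_{\mathfrak m}(f,B_{2r}(x))$ if $B_r(x)\cap\operatorname{supp}\mathfrak m\ne\emptyset$, else $0$. $f^\sharp(x)=\sup_{r\in(0,1]}r^{-1}\widetilde{\mathcal E}_{\mathfrak m_{k(r)}}(f,B_r(x))$ for $x\in X$; $\operatorname{CN}_p(f)=\|f\|_{L^p(\mathfrak m_0)}+\|f^\sharp\|_{L^p(\mu)}$. A finite family of closed balls $\{B_{r_i}(x_i)\}$ is $(S,c,\delta)$-nice if the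 balls are pairwise disjoint, $\max_ir_i\le\delta$, and $B_{cr_i}(x_i)\cap S\ne\emptyset$ for all $i$. $\operatorname{BSN}^\delta_{p,c}(f)=\|f\|_{L^p(\mathfrak m_0)}+\sup\big(\sum_{B\in\mathcal B}\mu(B)r(B)^{-p}\widetilde{\mathcal E}_{\mathfrak m_{k(B)}}(f,cB)^p\big)^{1/p}$, supremum over all $(S,c,\delta)$-nice families.
   Formalization: The second estimate is stated as BSN^δ(f) ≤ ‖f‖_{L^p(m_0)} + C_δ‖f^♯‖; this is equivalent when ‖f‖_{L^p(m_0)} is finite, and when it is infinite the difference in the English is ∞−∞, undefined (e.g. X=S=ℝ, f≡1), and nothing is claimed. *)

theory Defs
  imports "HOL-Analysis.Analysis"
begin

section \<open>Auxiliary: real powers of extended nonnegative reals (exponent t > 0)\<close>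

definition enn_powr :: "ennreal \<Rightarrow> real \<Rightarrow> ennreal" where
  "enn_powr a t = (if a = \<infinity> then \<infinity> else ennreal (enn2real a powr t))"

text \<open>X is the whole type 'a, a Polish space (complete separable metric space).
  Measures are measures on the Borel sigma-algebra.\<close>

definition mm_space :: "'a::polish_space measure \<Rightarrow> bool" where
  "mm_space \<mu> \<longleftrightarrow> sets \<mu> = sets borel \<and>
     (\<forall>x r. r > 0 \<longrightarrow> 0 < emeasure \<mu> (cball x r) \<and> emeasure \<mu> (cball x r) < \<infinity>)"

definition msupp :: "'a::metric_space measure \<Rightarrow> 'a set" where
  "msupp m = {x. \<forall>r>0. emeasure m (cball x r) > 0}"

definition is_measure_on :: "'a::polish_space measure \<Rightarrow> bool" where
  "is_measure_on m \<longleftrightarrow> sets m = sets borel \<and> emeasure m (space m) \<noteq> 0 \<and>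
     (\<forall>x. \<exists>r>0. emeasure m (cball x r) < \<infinity>)"

definition unif_loc_doubling :: "'a::metric_space measure \<Rightarrow> bool" where
  "unif_loc_doubling \<mu> \<longleftrightarrow> (\<forall>R>0. \<exists>D. \<forall>r\<in>{0<..R}. \<forall>x.
      emeasure \<mu> (cball x (2*r)) \<le> ennreal D * emeasure \<mu> (cball x r))"

definition lipp :: "('a::metric_space \<Rightarrow> real) \<Rightarrow> 'a \<Rightarrow> ennreal" where
  "lipp f x = (if x islimpt (UNIV::'a set)
      then Limsup (at x) (\<lambda>y. ennreal (\<bar>f y - f x\<bar> / dist x y)) else 0)"

definition osc :: "'a measure \<Rightarrow> ('a \<Rightarrow> real) \<Rightarrow> 'a set \<Rightarrow> ennreal" where
  "osc m f G = (INF c::real. (\<integral>\<^sup>+ y\<in>G. ennreal \<bar>f y - c\<bar> \<partial>m) / emeasure m G)"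

definition class_A :: "real \<Rightarrow> 'a::polish_space measure \<Rightarrow> bool" where
  "class_A q \<mu> \<longleftrightarrow> mm_space \<mu> \<and> unif_loc_doubling \<mu> \<and>
    (\<forall>R>0. \<exists>C>0. \<exists>lam\<ge>1. \<forall>f::'a \<Rightarrow> real. \<forall>x. \<forall>r\<in>{0<..R}.
       (\<exists>L. L-lipschitz_on UNIV f) \<longrightarrow>
       osc \<mu> f (cball x r) \<le> ennreal (C * r) *
         enn_powr ((\<integral>\<^sup>+ y\<in>cball x (lam*r). enn_powr (lipp f y) q \<partial>\<mu>)
                    / emeasure \<mu> (cball x (lam*r))) (1/q))"

definition haus_content :: "'a::metric_space measure \<Rightarrow> real \<Rightarrow> real \<Rightarrow> 'a set \<Rightarrow> ennreal" where
  "haus_content \<mu> \<theta> \<delta> E = (INF cov \<in> {(I, xc, rd). I \<subseteq> (UNIV::nat set) \<and>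
        (\<forall>i\<in>I. 0 < rd i \<and> rd i < \<delta>) \<and> E \<subseteq> (\<Union>i\<in>I. cball (xc i) (rd i))}.
      (case cov of (I, xc, rd) \<Rightarrow>
        (\<Sum>i. if i \<in> I then emeasure \<mu> (cball (xc i) (rd i)) / ennreal (rd i powr \<theta>) else 0)))"

definition LCR :: "'a::metric_space measure \<Rightarrow> real \<Rightarrow> 'a set \<Rightarrow> bool" where
  "LCR \<mu> \<theta> S \<longleftrightarrow> (\<exists>lam>0. \<forall>x\<in>S. \<forall>r\<in>{0<..1}.
      haus_content \<mu> \<theta> r (cball x r \<inter> S) \<ge> ennreal lam * emeasure \<mu> (cball x r) / ennreal (r powr \<theta>))"

definition in_M :: "'a::polish_space measure \<Rightarrow> real \<Rightarrow> 'a set \<Rightarrow> real \<Rightarrow> (nat \<Rightarrow> 'a measure) \<Rightarrow> bool" where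
  "in_M \<mu> \<theta> S \<epsilon> m \<longleftrightarrow>
     (\<forall>k. is_measure_on (m k)) \<and>
     (\<forall>k. msupp (m k) = S) \<and>
     (\<exists>C1>0. \<forall>k x r. 0 < r \<and> r \<le> \<epsilon> ^ k \<longrightarrow>
        emeasure (m k) (cball x r) \<le> ennreal C1 * emeasure \<mu> (cball x r) / ennreal (r powr \<theta>)) \<and>
     (\<exists>C2>0. \<forall>k. \<forall>x\<in>S. \<forall>r. \<epsilon> ^ k \<le> r \<and> r \<le> 1 \<longrightarrow>
        emeasure (m k) (cball x r) \<ge> ennreal C2 * emeasure \<mu> (cball x r) / ennreal (r powr \<theta>)) \<and>
     (\<exists>w::nat \<Rightarrow> 'a \<Rightarrow> real.
        (\<forall>k. w k \<in> borel_measurable borel \<and> (AE x in m 0. 0 \<le> w k x) \<and>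
             (\<exists>B. AE x in m 0. \<bar>w k x\<bar> \<le> B) \<and>
             m k = density (m 0) (\<lambda>x. ennreal (w k x))) \<and>
        (\<exists>C3>0. \<forall>k j. AE x in m 0. x \<in> S \<longrightarrow>
             \<epsilon> powr (\<theta> * real j) / C3 \<le> w k x / w (k + j) x \<and> w k x / w (k + j) x \<le> C3))"

definition loc_int :: "'a::metric_space measure \<Rightarrow> ('a \<Rightarrow> real) \<Rightarrow> bool" where
  "loc_int m f \<longleftrightarrow> (\<forall>x. \<exists>r>0. set_integrable m (cball x r) f)"

definition kidx :: "real \<Rightarrow> real \<Rightarrow> int" where
  "kidx \<epsilon> r = (GREATEST k::int. r \<le> \<epsilon> powi k)"

definition osc_t :: "'a::metric_space measure \<Rightarrow> ('a \<Rightarrow> real) \<Rightarrow> 'a \<Rightarrow> real \<Rightarrow> ennreal" where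
  "osc_t m f x r = (if cball x r \<inter> msupp m \<noteq> {} then osc m f (cball x (2*r)) else 0)"

definition sharp :: "real \<Rightarrow> (nat \<Rightarrow> 'a::metric_space measure) \<Rightarrow> ('a \<Rightarrow> real) \<Rightarrow> 'a \<Rightarrow> ennreal" where
  "sharp \<epsilon> m f x = (SUP r\<in>{0<..1}. osc_t (m (nat (kidx \<epsilon> r))) f x r / ennreal r)"

definition Lp_norm :: "real \<Rightarrow> 'a measure \<Rightarrow> ('a \<Rightarrow> real) \<Rightarrow> ennreal" where
  "Lp_norm p m f = enn_powr (\<integral>\<^sup>+ x. ennreal (\<bar>f x\<bar> powr p) \<partial>m) (1/p)"

definition Lp_norm_enn_on :: "real \<Rightarrow> 'a measure \<Rightarrow> 'a set \<Rightarrow> ('a \<Rightarrow> ennreal) \<Rightarrow> ennreal" where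
  "Lp_norm_enn_on p m U g = enn_powr (\<integral>\<^sup>+ x\<in>U. enn_powr (g x) p \<partial>m) (1/p)"

definition CN :: "real \<Rightarrow> 'a::metric_space measure \<Rightarrow> real \<Rightarrow> (nat \<Rightarrow> 'a measure) \<Rightarrow> ('a \<Rightarrow> real) \<Rightarrow> ennreal" where
  "CN p \<mu> \<epsilon> m f = Lp_norm p (m 0) f + Lp_norm_enn_on p \<mu> UNIV (sharp \<epsilon> m f)"

definition nice :: "'a::metric_space set \<Rightarrow> real \<Rightarrow> real \<Rightarrow> ('a \<times> real) set \<Rightarrow> bool" where
  "nice S c \<delta> \<B> \<longleftrightarrow> finite \<B> \<and> (\<forall>(x,r)\<in>\<B>. 0 < r \<and> r \<le> \<delta> \<and> cball x (c*r) \<inter> S \<noteq> {}) \<and>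
     (\<forall>(x,r)\<in>\<B>. \<forall>(y,s)\<in>\<B>. (x,r) \<noteq> (y,s) \<longrightarrow> cball x r \<inter> cball y s = {})"

definition BSN :: "'a::metric_space measure \<Rightarrow> 'a set \<Rightarrow> real \<Rightarrow> (nat \<Rightarrow> 'a measure) \<Rightarrow>
     real \<Rightarrow> real \<Rightarrow> real \<Rightarrow> ('a \<Rightarrow> real) \<Rightarrow> ennreal" where
  "BSN \<mu> S \<epsilon> m \<delta> p c f = Lp_norm p (m 0) f +
     (SUP \<B>\<in>{\<B>. nice S c \<delta> \<B>}. enn_powr (\<Sum>(x,r)\<in>\<B>.
        emeasure \<mu> (cball x r) / ennreal (r powr p) *
        enn_powr (osc_t (m (nat (kidx \<epsilon> r))) f x (c*r)) p) (1/p))"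

definition Unbhd :: "real \<Rightarrow> 'a::metric_space set \<Rightarrow> 'a set" where
  "Unbhd t S = {x. infdist x S < t}"

end

theory Submission
  imports Defs
begin

text \<open>For a ball \<open>B = B\<^bsub>r\<^esub>(x)\<close> with \<open>r \<le> 1/(4c)\<close> whose \<open>c\<close>-dilation meets \<open>S\<close>, the
  \<open>r\<close>-scaled oscillation of \<open>f\<close> over \<open>2cB\<close> is bounded, up to a constant, by \<open>f\<^sup>\<sharp>(y)\<close> for every
  \<open>y \<in> B\<close>: the ball of radius \<open>2(c + 1)r\<close> around \<open>y\<close> contains \<open>2cB\<close>, and doubling together with
  (M2)--(M4) makes the measures at both scales comparable. Integrating this over disjoint balls
  inside the neighbourhood of \<open>S\<close> gives the second estimate. For \<open>r > 1/(4c)\<close> the oscillation is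
  bounded by the \<open>L\<^sup>p\<close> average of \<open>f\<close>, and doubling bounds the overlap of the dilated balls.\<close>

text \<open>The obstacle is that the index k(r) fits neither (M2) nor (M3) directly. The upper bound
  is wanted at radius 2r, which may exceed \<epsilon>^k(r); the lower bound is wanted at radius r,
  which may be smaller than \<epsilon>^k(r). A neighbouring index fits in each case: one less for
  (M2), because 2\<epsilon> \<le> 1, and one more for (M3); (M4) pays for the move with a fixed
  factor. Likewise the indices of the scales r and (c + 1)r differ by an amount bounded in terms of
  c and \<epsilon>. The powers of r in the upper and lower bounds then cancel, so that no constant
  depends on the ball. For large balls the lower bound on r bounds k(r), hence the measure with
  index k(r) is at most a constant times \<open>m 0\<close>, and the average of \<bar>f\<bar>^p
  turns into the \<open>Lp_norm\<close> term of \<open>CN\<close>. Measurability of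
  \<open>sharp\<close> is never established: its integral is only bounded from below, by
  monotonicity, through finite sums of constants times indicators of balls.\<close>

section \<open>Powers and inverses of extended nonnegative reals\<close>

lemma enn_powr_ennreal: "0 \<le> x \<Longrightarrow> enn_powr (ennreal x) t = ennreal (x powr t)"
  by (simp add: enn_powr_def)

lemma enn_powr_mono:
  assumes "a \<le> b" "0 \<le> t"
  shows "enn_powr a t \<le> enn_powr b t"
proof (cases "b = \<infinity>")
  case False
  then have "enn2real a \<le> enn2real b" "a \<noteq> \<infinity>"
    using assms by (auto simp: enn2real_mono less_top top.extremum_unique)
  then show ?thesis
    using False assms by (auto simp: enn_powr_def intro!: ennreal_leI powr_mono2)
qed (simp add: enn_powr_def)

lemma enn_powr_cmult:
  assumes "0 < K"
  shows "enn_powr (ennreal K * a) t = ennreal (K powr t) * enn_powr a t"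
proof (cases a)
  case (real x)
  then show ?thesis
    using assms by (simp add: ennreal_mult[symmetric] enn_powr_ennreal powr_mult)
qed (use assms in \<open>simp add: enn_powr_def ennreal_mult_top\<close>)

text \<open>From a + b \<le> 2 max a b; this crude constant serves every exponent t \<ge> 0
  alike.\<close>

lemma enn_powr_add_le:
  assumes "0 \<le> t"
  shows "enn_powr (a + b) t \<le> ennreal (2 powr t) * (enn_powr a t + enn_powr b t)"
proof -
  have "enn_powr (a + b) t \<le> enn_powr (ennreal 2 * max a b) t"
    using assms by (intro enn_powr_mono)
      (auto simp: mult_2 max_def intro: add_mono)
  also have "\<dots> = ennreal (2 powr t) * enn_powr (max a b) t"
    by (rule enn_powr_cmult) simp
  also have "\<dots> \<le> ennreal (2 powr t) * (enn_powr a t + enn_powr b t)"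
    by (intro mult_left_mono) (auto simp: max_def)
  finally show ?thesis .
qed

text \<open>Serves to replace the denominator of an average without first checking that it is
  positive and finite: a = 0 forces b = 0, and then both inverses are infinite.\<close>

lemma ennreal_inverse_le_cmult:
  fixes a b :: ennreal
  assumes "b \<le> ennreal K * a" "0 < K"
  shows "inverse a \<le> ennreal K * inverse b"
proof (cases "a = 0 \<or> a = \<infinity> \<or> b = 0")
  case True
  then show ?thesis
    using assms by (auto simp: ennreal_mult_top)
next
  case False
  then obtain x where x: "a = ennreal x" "0 < x" by (cases a) (auto simp: zero_less_iff_neq_zero)
  then have "b \<noteq> \<infinity>" using assms by (auto simp: ennreal_mult[symmetric] top.extremum_unique)
  with False obtain y where y: "b = ennreal y" "0 < y" by (cases b) (auto simp: zero_less_iff_neq_zero)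
  have "y \<le> K * x" using assms x y by (simp add: ennreal_mult[symmetric])
  then have "inverse x \<le> K * inverse y" using x y by (simp add: field_simps)
  then show ?thesis
    using x y assms by (simp add: inverse_ennreal ennreal_mult[symmetric])
qed

section \<open>Oscillations: change of measure and set, and the bound by the p-th moment\<close>

text \<open>The two comparisons run in opposite directions: A controls the numerator of the average
  and B the denominator. Both act for each constant c separately, so they pass to the
  infimum.\<close>

lemma osc_mono_measure:
  assumes meas: "f \<in> borel_measurable m'"
    and sets: "G' \<in> sets m'" and G: "G \<subseteq> G'"
    and int: "\<And>g. g \<in> borel_measurable m' \<Longrightarrow> (\<integral>\<^sup>+ y. g y \<partial>m) \<le> ennreal A * (\<integral>\<^sup>+ y. g y \<partial>m')"
    and B: "emeasure m' G' \<le> ennreal B * emeasure m G" and pos: "0 < A" "0 < B"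
  shows "osc m f G \<le> ennreal (A * B) * osc m' f G'"
proof -
  have le: "osc m f G \<le> ennreal (A * B) * ((\<integral>\<^sup>+ y\<in>G'. ennreal \<bar>f y - c\<bar> \<partial>m') / emeasure m' G')" for c
  proof -
    have "osc m f G \<le> (\<integral>\<^sup>+ y\<in>G. ennreal \<bar>f y - c\<bar> \<partial>m) / emeasure m G"
      unfolding osc_def by (rule INF_lower) simp
    also have "(\<integral>\<^sup>+ y\<in>G. ennreal \<bar>f y - c\<bar> \<partial>m) \<le> (\<integral>\<^sup>+ y\<in>G'. ennreal \<bar>f y - c\<bar> \<partial>m)"
      using G by (intro nn_integral_mono) (auto split: split_indicator)
    also have "\<dots> \<le> ennreal A * (\<integral>\<^sup>+ y\<in>G'. ennreal \<bar>f y - c\<bar> \<partial>m')"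
      using meas sets by (intro int borel_measurable_times_ennreal borel_measurable_indicator) auto
    finally have "osc m f G \<le> (ennreal A * (\<integral>\<^sup>+ y\<in>G'. ennreal \<bar>f y - c\<bar> \<partial>m')) * inverse (emeasure m G)"
      by (simp add: divide_ennreal_def mult_right_mono)
    also have "\<dots> \<le> (ennreal A * (\<integral>\<^sup>+ y\<in>G'. ennreal \<bar>f y - c\<bar> \<partial>m')) * (ennreal B * inverse (emeasure m' G'))"
      by (intro mult_left_mono ennreal_inverse_le_cmult B pos) simp
    also have "\<dots> = ennreal (A * B) * ((\<integral>\<^sup>+ y\<in>G'. ennreal \<bar>f y - c\<bar> \<partial>m') / emeasure m' G')"
      using pos by (simp add: ennreal_mult divide_ennreal_def mult_ac)
    finally show ?thesis .
  qed
  \<comment> \<open>Dividing on the left frees the infimum on the right from the factor, so that it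
    can be bounded from below term by term.\<close>
  have "osc m f G / ennreal (A * B) \<le> osc m' f G'"
    unfolding osc_def[of m'] using pos le
    by (intro INF_greatest divide_le_posI_ennreal) (auto simp: mult.commute)
  then have "ennreal (A * B) * (osc m f G / ennreal (A * B)) \<le> ennreal (A * B) * osc m' f G'"
    by (rule mult_left_mono) simp
  then show ?thesis
    using pos by (simp add: ennreal_times_divide ennreal_mult_divide_eq mult.commute[of "ennreal _"])
qed

text \<open>A version of Jensen's inequality with a harmless factor, from
  \<open>t \<le> a + a\<^sup>1\<^sup>-\<^sup>p t\<^sup>p\<close> with \<open>a\<close> the \<open>L\<^sup>p\<close> average of \<open>\<bar>f\<bar>\<close>.\<close>
lemma osc_powr_le:
  assumes p: "1 < p" and f: "f \<in> borel_measurable m" and G: "G \<in> sets m"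
  shows "enn_powr (osc m f G) p \<le>
    ennreal (2 powr p) * ((\<integral>\<^sup>+ y\<in>G. ennreal (\<bar>f y\<bar> powr p) \<partial>m) / emeasure m G)"
proof -
  define I where "I = (\<integral>\<^sup>+ y\<in>G. ennreal (\<bar>f y\<bar> powr p) \<partial>m)"
  have osc0: "osc m f G \<le> (\<integral>\<^sup>+ y\<in>G. ennreal \<bar>f y\<bar> \<partial>m) / emeasure m G"
    unfolding osc_def by (rule INF_lower2[of 0]) auto
  \<comment> \<open>The first two cases are degenerate and give oscillation 0, by 0/0 = 0 and
    x/\<infinity> = 0.\<close>
  consider "emeasure m G = 0" | "emeasure m G = \<infinity>" | "0 < emeasure m G" "emeasure m G < \<infinity>"
    by (metis less_top infinity_ennreal_def zero_less_iff_neq_zero)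
  then show ?thesis
  proof cases
    case 1
    then have "(\<integral>\<^sup>+ y\<in>G. ennreal \<bar>f y\<bar> \<partial>m) = 0"
      using f G by (subst nn_integral_null_set) auto
    then have "osc m f G = 0" using osc0 by simp
    then show ?thesis using p by (simp add: enn_powr_def)
  next
    case 2
    then have "osc m f G = 0" using osc0 by simp
    then show ?thesis using p by (simp add: enn_powr_def)
  next
    case 3
    \<comment> \<open>A strictly positive \<beta> above the average replaces the average itself: if
      the average is 0 then a would be 0, and \<open>a powr (1 - p)\<close> would take the default
      value 0 instead of blowing up.\<close>
    have bound: "enn_powr (osc m f G) p \<le> ennreal (2 powr p * \<beta>)"
      if \<beta>: "0 < \<beta>" "I / emeasure m G \<le> ennreal \<beta>" for \<beta>
    proof -
      \<comment> \<open>This choice balances the two terms of the inequality for t: after averaging,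
        each contributes at most a.\<close>
      define a where "a = \<beta> powr (1/p)"
      have a: "0 < a" "a powr (1 - p) * \<beta> = a"
        using \<beta>(1) p by (auto simp: a_def powr_powr powr_add[symmetric] powr_mult_base field_simps)
      have young: "\<bar>t\<bar> \<le> a + a powr (1 - p) * \<bar>t\<bar> powr p" for t
      proof (cases "\<bar>t\<bar> \<le> a")
        case False
        then have "\<bar>t\<bar> powr (1 - p) \<le> a powr (1 - p)"
          using a p by (intro powr_mono2') auto
        then have "\<bar>t\<bar> powr (1 - p) * \<bar>t\<bar> powr p \<le> a powr (1 - p) * \<bar>t\<bar> powr p"
          by (intro mult_right_mono) auto
        moreover have "\<bar>t\<bar> powr (1 - p) * \<bar>t\<bar> powr p = \<bar>t\<bar>"
          using False a by (simp add: powr_add[symmetric])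
        ultimately show ?thesis using a by simp
      qed (simp add: add_increasing2)
      have "(\<integral>\<^sup>+ y\<in>G. ennreal \<bar>f y\<bar> \<partial>m) \<le>
          (\<integral>\<^sup>+ y. ennreal a * indicator G y + ennreal (a powr (1 - p)) * (ennreal (\<bar>f y\<bar> powr p) * indicator G y) \<partial>m)"
        using a(1) young
        by (intro nn_integral_mono)
          (auto split: split_indicator simp: ennreal_mult[symmetric] ennreal_plus[symmetric] simp del: ennreal_plus intro!: ennreal_leI)
      also have "\<dots> = ennreal a * emeasure m G + ennreal (a powr (1 - p)) * I"
        unfolding I_def using f G by (subst nn_integral_add) (auto simp: nn_integral_cmult)
      finally have "osc m f G \<le> (ennreal a * emeasure m G + ennreal (a powr (1 - p)) * I) / emeasure m G"
        using osc0 by (meson divide_right_mono_ennreal order_trans)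
      also have "\<dots> = ennreal a * (emeasure m G / emeasure m G) + ennreal (a powr (1 - p)) * (I / emeasure m G)"
        by (simp add: divide_ennreal_def distrib_left mult_ac)
      also have "emeasure m G / emeasure m G = 1"
        using 3 by (intro ennreal_divide_self) auto
      also have "ennreal a * 1 + ennreal (a powr (1 - p)) * (I / emeasure m G)
          \<le> ennreal a + ennreal (a powr (1 - p)) * ennreal \<beta>"
        using \<beta> by (auto intro: add_mono mult_left_mono)
      also have "\<dots> = ennreal (2 * a)"
        using a \<beta> by (simp add: ennreal_mult[symmetric] ennreal_plus[symmetric] del: ennreal_plus)
      finally have "enn_powr (osc m f G) p \<le> enn_powr (ennreal (2 * a)) p"
        using p by (intro enn_powr_mono) auto
      also have "\<dots> = ennreal (2 powr p * \<beta>)"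
        using a \<beta> p by (subst enn_powr_ennreal) (auto simp: powr_mult a_def powr_powr)
      finally show ?thesis .
    qed
    show ?thesis
    proof (cases "I / emeasure m G")
      case (real b)
      have "enn_powr (osc m f G) p \<le> ennreal (2 powr p * b) + ennreal e" if "0 < e" for e
      proof -
        \<comment> \<open>\<beta> exceeds the average b by e / 2^p, so the factor 2^p turns the
          excess into e.\<close>
        have "enn_powr (osc m f G) p \<le> ennreal (2 powr p * (b + e / 2 powr p))"
          using that real by (intro bound) (auto intro!: add_nonneg_pos ennreal_leI)
        also have "\<dots> = ennreal (2 powr p * b) + ennreal e"
          using that real by (simp add: ennreal_plus[symmetric] distrib_left del: ennreal_plus)
        finally show ?thesis .
      qed
      then show ?thesis
        unfolding I_def[symmetric] using real
        by (subst real) (rule ennreal_le_epsilon, simp add: ennreal_mult)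
    next
      case top
      have "ennreal (2 powr p) * top = top" by (simp add: ennreal_mult_top)
      then show ?thesis unfolding I_def[symmetric] top by (simp only: top_greatest)
    qed
  qed
qed

section \<open>Doubling at arbitrary dilations and the scale index\<close>

lemma doubling_cball:
  assumes "unif_loc_doubling \<mu>" "mm_space \<mu>"
  obtains D where "0 < D"
    "\<And>z r. \<lbrakk>0 < r; r \<le> 1\<rbrakk> \<Longrightarrow> emeasure \<mu> (cball z (T * r)) \<le> ennreal D * emeasure \<mu> (cball z r)"
proof -
  have sets: "sets \<mu> = sets borel" using assms by (simp add: mm_space_def)
  obtain n :: nat where n: "T < 2 ^ n"
    using real_arch_pow[of 2 T] by auto
  \<comment> \<open>Starting from r \<le> 1, the radii met in n doublings stay below 2^n, so one
    local doubling constant serves all of them.\<close>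
  obtain D where D: "\<And>r x. 0 < r \<Longrightarrow> r \<le> 2 ^ n \<Longrightarrow>
      emeasure \<mu> (cball x (2*r)) \<le> ennreal D * emeasure \<mu> (cball x r)"
    using assms(1) unfolding unif_loc_doubling_def by (meson greaterThanAtMost_iff zero_less_numeral zero_less_power)
  \<comment> \<open>The real D may be negative, where \<open>ennreal D\<close> is 0;
    \<open>max 1 D\<close> keeps the powers positive.\<close>
  have iter: "emeasure \<mu> (cball z (2 ^ j * r)) \<le> ennreal (max 1 D ^ j) * emeasure \<mu> (cball z r)"
    if "0 < r" "r \<le> 1" "j \<le> n" for z r j
    using \<open>j \<le> n\<close>
  proof (induction j)
    case (Suc j)
    have "2 ^ j * r \<le> 2 ^ n * 1"
      using Suc.prems that by (intro mult_mono power_increasing) auto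
    then have "emeasure \<mu> (cball z (2 * (2 ^ j * r))) \<le> ennreal D * emeasure \<mu> (cball z (2 ^ j * r))"
      using that by (intro D) auto
    also have "\<dots> \<le> ennreal (max 1 D) * (ennreal (max 1 D ^ j) * emeasure \<mu> (cball z r))"
      using Suc by (intro mult_mono ennreal_leI) auto
    finally show ?case by (simp add: mult.assoc[symmetric] ennreal_mult[symmetric])
  qed simp
  show ?thesis
  proof
    show "0 < max 1 D ^ n" by (simp add: less_max_iff_disj)
    show "emeasure \<mu> (cball z (T * r)) \<le> ennreal (max 1 D ^ n) * emeasure \<mu> (cball z r)"
      if "0 < r" "r \<le> 1" for z r
    proof -
      have "emeasure \<mu> (cball z (T * r)) \<le> emeasure \<mu> (cball z (2 ^ n * r))"
        using n that by (intro emeasure_mono subset_cball) (auto simp: sets)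
      also have "\<dots> \<le> ennreal (max 1 D ^ n) * emeasure \<mu> (cball z r)"
        using that by (intro iter) auto
      finally show ?thesis .
    qed
  qed
qed

text \<open>For r \<le> 1 the index is nonnegative, so \<open>nat\<close> loses nothing: the least n
  with \<epsilon>^n < r is not 0, and the index is its predecessor. The second conclusion is
  maximality of the index.\<close>

lemma kidx_props:
  assumes \<epsilon>: "0 < \<epsilon>" "\<epsilon> < 1" and r: "0 < r" "r \<le> 1"
  shows "r \<le> \<epsilon> ^ nat (kidx \<epsilon> r)" "\<epsilon> ^ Suc (nat (kidx \<epsilon> r)) < r"
proof -
  have ex: "\<exists>n. \<epsilon> ^ n < r" using real_arch_pow_inv[OF r(1) \<epsilon>(2)] .
  define n where "n = (LEAST n. \<epsilon> ^ n < r)"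
  have n: "\<epsilon> ^ n < r" unfolding n_def using ex by (rule LeastI_ex)
  then have "n \<noteq> 0" using r by (intro notI) simp
  then obtain k where k: "n = Suc k" using not0_implies_Suc by blast
  have "\<not> \<epsilon> ^ k < r" using not_less_Least[of k "\<lambda>n. \<epsilon> ^ n < r"] k by (simp add: n_def)
  then have rk: "r \<le> \<epsilon> ^ k" by simp
  have "kidx \<epsilon> r = int k" unfolding kidx_def
  proof (rule Greatest_equality)
    show "r \<le> \<epsilon> powi int k" using rk by simp
    show "y \<le> int k" if y: "r \<le> \<epsilon> powi y" for y
    proof (rule ccontr)
      assume "\<not> y \<le> int k"
      then have "Suc k \<le> nat y" and "0 \<le> y" by auto
      then have "\<epsilon> powi y \<le> \<epsilon> ^ Suc k"
        using \<epsilon> by (subst power_int_def) (auto simp del: power_Suc intro!: power_decreasing)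
      then show False using y n k by simp
    qed
  qed
  then show "r \<le> \<epsilon> ^ nat (kidx \<epsilon> r)" "\<epsilon> ^ Suc (nat (kidx \<epsilon> r)) < r"
    using rk n k by auto
qed

section \<open>Measurability and support through countable covers\<close>

text \<open>Integrability on a ball makes f measurable there. The radius depends on the centre, so
  Lindelof first selects countably many open balls that cover the space.\<close>

lemma loc_int_imp_borel_measurable:
  fixes f :: "'a::polish_space \<Rightarrow> real"
  assumes sets: "sets m = sets borel" and f: "loc_int m f"
  shows "f \<in> borel_measurable borel"
proof -
  from f obtain \<rho> where \<rho>: "\<And>x. 0 < \<rho> x" "\<And>x. set_integrable m (cball x (\<rho> x)) f"
    unfolding loc_int_def by metis
  obtain F' where F': "F' \<subseteq> range (\<lambda>x. ball x (\<rho> x))" "countable F'"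
      "\<Union>F' = \<Union>(range (\<lambda>x. ball x (\<rho> x)))"
    by (rule Lindelof[of "range (\<lambda>x. ball x (\<rho> x))"]) auto
  have U: "\<Union>F' = UNIV" using \<rho>(1) F'(3) by (auto intro!: centre_in_ball[THEN iffD2])
  show ?thesis
  proof (rule measurable_piecewise_restrict[OF F'(2)])
    show "space borel \<subseteq> \<Union>F'" using U by simp
    fix \<Omega> assume "\<Omega> \<in> F'"
    then obtain x where x: "\<Omega> = ball x (\<rho> x)" using F'(1) by auto
    show "\<Omega> \<inter> space borel \<in> sets borel" using x by simp
    have "(\<lambda>y. indicator (cball x (\<rho> x)) y *\<^sub>R f y) \<in> borel_measurable borel"
      using \<rho>(2)[of x] borel_measurable_integrable unfolding set_integrable_def
      by (metis measurable_cong_sets sets)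
    then have "(\<lambda>y. indicator \<Omega> y *\<^sub>R (indicator (cball x (\<rho> x)) y *\<^sub>R f y)) \<in> borel_measurable borel"
      by (rule borel_measurable_scaleR[OF borel_measurable_indicator, rotated]) (use x in auto)
    moreover have "(\<lambda>y. indicator \<Omega> y *\<^sub>R (indicator (cball x (\<rho> x)) y *\<^sub>R f y)) = (\<lambda>y. indicator \<Omega> y *\<^sub>R f y)"
      using x by (auto simp: fun_eq_iff split: split_indicator)
    ultimately show "f \<in> borel_measurable (restrict_space borel \<Omega>)"
      using x by (subst borel_measurable_restrict_space_iff) auto
  qed
qed

text \<open>The complement of the support is covered by null balls, countably many of which suffice
  by Lindelof. This turns the comparison of weights in (M4), stated on S, into one almost
  everywhere.\<close>

lemma AE_in_msupp:
  fixes m :: "'a::polish_space measure"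
  assumes sets: "sets m = sets borel"
  shows "AE x in m. x \<in> msupp m"
proof -
  have "\<forall>x\<in>- msupp m. \<exists>r>0. emeasure m (cball x r) = 0"
    by (auto simp: msupp_def zero_less_iff_neq_zero)
  then obtain \<rho> where \<rho>: "\<And>x. x \<in> - msupp m \<Longrightarrow> 0 < \<rho> x \<and> emeasure m (cball x (\<rho> x)) = 0"
    by metis
  obtain F' where F': "F' \<subseteq> (\<lambda>x. ball x (\<rho> x)) ` (- msupp m)" "countable F'"
      "\<Union>F' = \<Union>((\<lambda>x. ball x (\<rho> x)) ` (- msupp m))"
    by (rule Lindelof[of "(\<lambda>x. ball x (\<rho> x)) ` (- msupp m)"]) auto
  have "\<Union>F' \<in> null_sets m"
  proof (rule null_sets_UN'[OF F'(2), where N = id, simplified])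
    fix \<Omega> assume "\<Omega> \<in> F'"
    then obtain x where x: "x \<in> - msupp m" "\<Omega> = ball x (\<rho> x)" using F'(1) by auto
    then have "cball x (\<rho> x) \<in> null_sets m" using \<rho> by (auto simp: null_sets_def sets)
    then show "\<Omega> \<in> null_sets m"
      by (rule null_sets_subset) (auto simp: x sets)
  qed
  moreover have "- msupp m \<subseteq> \<Union>F'" using \<rho> F'(3) by auto
  ultimately show ?thesis by (intro AE_I') auto
qed

section \<open>Comparing the measures with each other and with \<mu>\<close>

lemma in_M_sets: "in_M \<mu> \<theta> S \<epsilon> m \<Longrightarrow> sets (m k) = sets borel"
  unfolding in_M_def is_measure_on_def by (elim conjE allE[of _ k])

lemma in_M_msupp: "in_M \<mu> \<theta> S \<epsilon> m \<Longrightarrow> msupp (m k) = S"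
  unfolding in_M_def by (elim conjE) (rule spec)

text \<open>The lower bound on w_k / w_(k+j) in (M4) reads w_(k+j) \<le> C3 \<epsilon>^(-\<theta>j)
  w_k; integrate it against g.\<close>

lemma in_M_nn_integral_le:
  assumes M: "in_M \<mu> \<theta> S \<epsilon> m" and \<epsilon>: "0 < \<epsilon>"
  obtains C where "0 < C"
    "\<And>k j g. g \<in> borel_measurable borel \<Longrightarrow>
      (\<integral>\<^sup>+ y. g y \<partial>m (k + j)) \<le> ennreal (C / \<epsilon> powr (\<theta> * real j)) * (\<integral>\<^sup>+ y. g y \<partial>m k)"
proof -
  from M have "\<exists>w::nat \<Rightarrow> 'a \<Rightarrow> real.
        (\<forall>k. w k \<in> borel_measurable borel \<and> (AE x in m 0. 0 \<le> w k x) \<and>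
             (\<exists>B. AE x in m 0. \<bar>w k x\<bar> \<le> B) \<and>
             m k = density (m 0) (\<lambda>x. ennreal (w k x))) \<and>
        (\<exists>C3>0. \<forall>k j. AE x in m 0. x \<in> S \<longrightarrow>
             \<epsilon> powr (\<theta> * real j) / C3 \<le> w k x / w (k + j) x \<and> w k x / w (k + j) x \<le> C3)"
    unfolding in_M_def by (elim conjE)
  then obtain w :: "nat \<Rightarrow> 'a \<Rightarrow> real" where w': "(\<forall>k. w k \<in> borel_measurable borel \<and> (AE x in m 0. 0 \<le> w k x) \<and>
             (\<exists>B. AE x in m 0. \<bar>w k x\<bar> \<le> B) \<and>
             m k = density (m 0) (\<lambda>x. ennreal (w k x))) \<and>
        (\<exists>C3>0. \<forall>k j. AE x in m 0. x \<in> S \<longrightarrow>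
             \<epsilon> powr (\<theta> * real j) / C3 \<le> w k x / w (k + j) x \<and> w k x / w (k + j) x \<le> C3)"
    by (rule exE)
  then obtain C3 where C3: "0 < C3 \<and> (\<forall>k j. AE x in m 0. x \<in> S \<longrightarrow>
      \<epsilon> powr (\<theta> * real j) / C3 \<le> w k x / w (k + j) x \<and> w k x / w (k + j) x \<le> C3)"
    by (elim conjE) (rule exE)
  note w = w'[THEN conjunct1, rule_format]
  have lower: "AE x in m 0. x \<in> S \<longrightarrow> \<epsilon> powr (\<theta> * real j) / C3 \<le> w k x / w (k + j) x" for k j
    using C3[THEN conjunct2, rule_format, of j k] by (rule eventually_mono) blast
  have meas_w: "w k \<in> borel_measurable borel" for k
    using w[of k] by (elim conjE)
  have pos_w: "AE x in m 0. 0 \<le> w k x" for k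
    using w[of k] by (elim conjE)
  have s: "sets (m 0) = sets borel"
    by (rule in_M_sets[OF M])
  have S: "AE x in m 0. x \<in> S" using AE_in_msupp[OF s] in_M_msupp[OF M] by simp
  have meas: "h \<in> borel_measurable (m 0)" if "h \<in> borel_measurable borel" for h :: "'a \<Rightarrow> ennreal"
    using that measurable_cong_sets[OF s refl] by blast
  have "(\<integral>\<^sup>+ y. g y \<partial>m (k + j)) \<le> ennreal (C3 / \<epsilon> powr (\<theta> * real j)) * (\<integral>\<^sup>+ y. g y \<partial>m k)"
    if g: "g \<in> borel_measurable borel" for k j g
  proof -
    define e where "e = \<epsilon> powr (\<theta> * real j)"
    have e: "0 < e" using \<epsilon> by (simp add: e_def)
    have int: "(\<integral>\<^sup>+ y. g y \<partial>m i) = (\<integral>\<^sup>+ y. ennreal (w i y) * g y \<partial>m 0)" for i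
      by (subst w[of i, THEN conjunct2, THEN conjunct2, THEN conjunct2], rule nn_integral_density)
        (use meas_w g in \<open>auto intro!: meas\<close>)
    have "AE y in m 0. ennreal (w (k + j) y) * g y \<le> ennreal (C3 / e) * (ennreal (w k y) * g y)"
      using lower[of j k] pos_w[of k] pos_w[of "k + j"] S
    proof eventually_elim
      case (elim y)
      \<comment> \<open>A vanishing denominator would make the quotient 0 by convention, below the
        positive bound \<open>e / C3\<close>.\<close>
      have "0 < e / C3" using e C3 by simp
      then have "w (k + j) y \<noteq> 0" using elim by (intro notI) (simp add: e_def[symmetric])
      then have "w (k + j) y \<le> C3 / e * w k y"
        using elim e C3 by (simp add: field_simps e_def[symmetric])
      then have "ennreal (w (k + j) y) \<le> ennreal (C3 / e) * ennreal (w k y)"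
        using elim e C3 by (simp add: ennreal_mult[symmetric] ennreal_leI)
      then show ?case by (simp add: mult.assoc[symmetric] mult_right_mono)
    qed
    then have "(\<integral>\<^sup>+ y. ennreal (w (k + j) y) * g y \<partial>m 0) \<le> (\<integral>\<^sup>+ y. ennreal (C3 / e) * (ennreal (w k y) * g y) \<partial>m 0)"
      by (rule nn_integral_mono_AE)
    also have "\<dots> = ennreal (C3 / e) * (\<integral>\<^sup>+ y. ennreal (w k y) * g y \<partial>m 0)"
      using meas_w g by (intro nn_integral_cmult meas) measurable
    finally show ?thesis by (simp add: int e_def)
  qed
  then show ?thesis using that C3 by blast
qed

lemma ennreal_cmult_divide:
  "\<lbrakk>0 \<le> a; 0 < b\<rbrakk> \<Longrightarrow> ennreal a * X / ennreal b = ennreal (a / b) * X"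
  by (simp add: divide_ennreal_def inverse_ennreal divide_inverse ennreal_mult mult_ac)

lemma ennreal_cmult_cmult:
  "0 \<le> a \<Longrightarrow> 0 \<le> b \<Longrightarrow> ennreal a * (ennreal b * X) = ennreal (a * b) * X"
  by (simp add: ennreal_mult mult.assoc)

lemma cball_subset_cballI: "dist x z + r \<le> R \<Longrightarrow> cball z r \<subseteq> cball x R"
  for x z :: "'a::metric_space"
proof
  show "y \<in> cball x R" if "dist x z + r \<le> R" "y \<in> cball z r" for y
    using that dist_triangle[of x y z] by simp
qed

lemma in_M_emeasure_le:
  assumes M: "in_M \<mu> \<theta> S \<epsilon> m" and \<epsilon>: "0 < \<epsilon>"
  obtains C where "0 < C"
    "\<And>k j A. A \<in> sets borel \<Longrightarrow>
      emeasure (m (k + j)) A \<le> ennreal (C / \<epsilon> powr (\<theta> * real j)) * emeasure (m k) A"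
proof -
  obtain C where C: "0 < C" and le: "\<And>k j g. g \<in> borel_measurable borel \<Longrightarrow>
      (\<integral>\<^sup>+ y. g y \<partial>m (k + j)) \<le> ennreal (C / \<epsilon> powr (\<theta> * real j)) * (\<integral>\<^sup>+ y. g y \<partial>m k)"
    using in_M_nn_integral_le[OF M \<epsilon>] by blast
  have "emeasure (m (k + j)) A \<le> ennreal (C / \<epsilon> powr (\<theta> * real j)) * emeasure (m k) A"
    if "A \<in> sets borel" for k j A
    using le[of "indicator A" k j] that in_M_sets[OF M] by simp
  with C that show ?thesis by blast
qed

text \<open>(M2) at index k(r) covers radii up to \<epsilon>^k(r), and 2r may be larger. The
  preceding index k' works, since 2r \<le> 2\<epsilon> \<epsilon>^k' \<le> \<epsilon>^k'. At index 0
  there is none, and 2r \<le> 1 takes over.\<close>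

lemma in_M_upper:
  assumes M: "in_M \<mu> \<theta> S \<epsilon> m" and \<epsilon>: "0 < \<epsilon>" "\<epsilon> \<le> 1/10" and \<theta>: "0 \<le> \<theta>"
  obtains K where "0 < K"
    "\<And>x r. \<lbrakk>0 < r; 2 * r \<le> 1\<rbrakk> \<Longrightarrow>
      emeasure (m (nat (kidx \<epsilon> r))) (cball x (2*r)) \<le> ennreal (K / r powr \<theta>) * emeasure \<mu> (cball x (2*r))"
proof -
  have "\<exists>C1>0. \<forall>k x r. 0 < r \<and> r \<le> \<epsilon> ^ k \<longrightarrow>
        emeasure (m k) (cball x r) \<le> ennreal C1 * emeasure \<mu> (cball x r) / ennreal (r powr \<theta>)"
    using M unfolding in_M_def by (elim conjE)
  then obtain C1 where C1: "0 < C1" and up: "\<And>k x r. \<lbrakk>0 < r; r \<le> \<epsilon> ^ k\<rbrakk> \<Longrightarrow>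
        emeasure (m k) (cball x r) \<le> ennreal (C1 / r powr \<theta>) * emeasure \<mu> (cball x r)"
    by (auto simp: ennreal_cmult_divide)
  obtain C where C: "0 < C" and le: "\<And>k j A. A \<in> sets borel \<Longrightarrow>
      emeasure (m (k + j)) A \<le> ennreal (C / \<epsilon> powr (\<theta> * real j)) * emeasure (m k) A"
    using in_M_emeasure_le[OF M \<epsilon>(1)] by blast
  define L where "L = max 1 (C / \<epsilon> powr \<theta>)"
  have L: "1 \<le> L" "C / \<epsilon> powr \<theta> \<le> L" by (auto simp: L_def)
  show ?thesis
  proof
    show "0 < L * C1" using L C1 by simp
    fix x :: 'a and r :: real
    assume r: "0 < r" "2 * r \<le> 1"
    let ?G = "cball x (2 * r)"
    have k: "r \<le> \<epsilon> ^ nat (kidx \<epsilon> r)" using kidx_props[of \<epsilon> r] \<epsilon> r by auto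
    obtain k' where k': "2 * r \<le> \<epsilon> ^ k'" "emeasure (m (nat (kidx \<epsilon> r))) ?G \<le> ennreal L * emeasure (m k') ?G"
    proof (cases "nat (kidx \<epsilon> r)")
      case 0
      have "1 * emeasure (m 0) ?G \<le> ennreal L * emeasure (m 0) ?G"
        using L by (intro mult_right_mono) (auto simp: one_ennreal.rep_eq ennreal_le_1 simp flip: ennreal_1)
      then show ?thesis using that[of 0] r 0 by simp
    next
      case (Suc k')
      have "2 * r \<le> 2 * (\<epsilon> * \<epsilon> ^ k')" using k Suc by simp
      also have "\<dots> \<le> \<epsilon> ^ k'" using \<epsilon> by (simp add: mult_left_le_one_le flip: mult.assoc)
      finally have "2 * r \<le> \<epsilon> ^ k'" .
      moreover have "emeasure (m (k' + 1)) ?G \<le> ennreal (C / \<epsilon> powr \<theta>) * emeasure (m k') ?G"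
        using le[of ?G k' 1] by simp
      moreover have "\<dots> \<le> ennreal L * emeasure (m k') ?G"
        by (intro mult_right_mono ennreal_leI L) simp
      ultimately show ?thesis using that[of k'] Suc by simp
    qed
    note k'(2)
    also have "ennreal L * emeasure (m k') ?G \<le> ennreal L * (ennreal (C1 / (2 * r) powr \<theta>) * emeasure \<mu> ?G)"
      using r k' by (intro mult_left_mono up) auto
    also have "\<dots> = ennreal (L * (C1 / (2 * r) powr \<theta>)) * emeasure \<mu> ?G"
      using L C1 by (intro ennreal_cmult_cmult) auto
    also have "\<dots> \<le> ennreal (L * C1 / r powr \<theta>) * emeasure \<mu> ?G"
    proof (intro mult_right_mono ennreal_leI)
      have "r powr \<theta> \<le> (2 * r) powr \<theta>" using r \<theta> by (intro powr_mono2) auto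
      then show "L * (C1 / (2 * r) powr \<theta>) \<le> L * C1 / r powr \<theta>"
        using r L C1 by (simp add: frac_le)
    qed simp
    finally show "emeasure (m (nat (kidx \<epsilon> r))) ?G \<le> ennreal (L * C1 / r powr \<theta>) * emeasure \<mu> ?G" .
  qed
qed

text \<open>(M3) at index k(r) would need \<epsilon>^k(r) \<le> r, the reverse of what the index
  guarantees. The next index satisfies it, and its measure is at most a constant times the one
  wanted.\<close>

lemma in_M_lower:
  assumes M: "in_M \<mu> \<theta> S \<epsilon> m" and \<epsilon>: "0 < \<epsilon>" "\<epsilon> < 1"
  obtains K where "0 < K"
    "\<And>z r. \<lbrakk>z \<in> S; 0 < r; r \<le> 1\<rbrakk> \<Longrightarrow>
      emeasure \<mu> (cball z r) \<le> ennreal (K * r powr \<theta>) * emeasure (m (nat (kidx \<epsilon> r))) (cball z r)"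
proof -
  have "\<exists>C2>0. \<forall>k. \<forall>x\<in>S. \<forall>r. \<epsilon> ^ k \<le> r \<and> r \<le> 1 \<longrightarrow>
        emeasure (m k) (cball x r) \<ge> ennreal C2 * emeasure \<mu> (cball x r) / ennreal (r powr \<theta>)"
    using M unfolding in_M_def by (elim conjE)
  then obtain C2 where C2: "0 < C2" and low: "\<And>k x r. \<lbrakk>x \<in> S; \<epsilon> ^ k \<le> r; r \<le> 1\<rbrakk> \<Longrightarrow>
        ennreal C2 * emeasure \<mu> (cball x r) / ennreal (r powr \<theta>) \<le> emeasure (m k) (cball x r)"
    by blast
  obtain C where C: "0 < C" and le: "\<And>k j A. A \<in> sets borel \<Longrightarrow>
      emeasure (m (k + j)) A \<le> ennreal (C / \<epsilon> powr (\<theta> * real j)) * emeasure (m k) A"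
    using in_M_emeasure_le[OF M \<epsilon>(1)] by blast
  show ?thesis
  proof
    show "0 < C / (C2 * \<epsilon> powr \<theta>)" using C C2 \<epsilon> by simp
    fix z and r :: real assume z: "z \<in> S" and r: "0 < r" "r \<le> 1"
    define k where "k = nat (kidx \<epsilon> r)"
    have "\<epsilon> ^ (k + 1) < r" using kidx_props(2)[OF \<epsilon> r] by (simp add: k_def)
    then have "ennreal C2 * emeasure \<mu> (cball z r) / ennreal (r powr \<theta>) \<le> emeasure (m (k + 1)) (cball z r)"
      using z r by (intro low) auto
    also have "\<dots> \<le> ennreal (C / \<epsilon> powr \<theta>) * emeasure (m k) (cball z r)"
      using le[of "cball z r" k 1] by simp
    finally have *: "ennreal (C2 / r powr \<theta>) * emeasure \<mu> (cball z r)
        \<le> ennreal (C / \<epsilon> powr \<theta>) * emeasure (m k) (cball z r)"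
      using r C2 by (simp add: ennreal_cmult_divide)
    have "emeasure \<mu> (cball z r) = ennreal (r powr \<theta> / C2) * (ennreal (C2 / r powr \<theta>) * emeasure \<mu> (cball z r))"
      using r C2 by (subst ennreal_cmult_cmult) auto
    also have "\<dots> \<le> ennreal (r powr \<theta> / C2) * (ennreal (C / \<epsilon> powr \<theta>) * emeasure (m k) (cball z r))"
      by (intro mult_left_mono *) simp
    also have "\<dots> = ennreal (C / (C2 * \<epsilon> powr \<theta>) * r powr \<theta>) * emeasure (m k) (cball z r)"
      using C C2 by (subst ennreal_cmult_cmult) (auto simp: mult_ac)
    finally show "emeasure \<mu> (cball z r)
        \<le> ennreal (C / (C2 * \<epsilon> powr \<theta>) * r powr \<theta>) * emeasure (m (nat (kidx \<epsilon> r))) (cball z r)"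
      by (simp only: k_def)
  qed
qed

text \<open>The centre x need not lie in S, so (M3) is applied at a point z of S in the c-dilated
  ball. The ball of radius Tr around x lies in that of radius (T + c)r around z, which doubling
  reduces to radius r; and the ball of radius r around z lies in that of radius 2cr around x because
  c \<ge> 1.\<close>

lemma in_M_lower_near:
  assumes \<mu>: "unif_loc_doubling \<mu>" "mm_space \<mu>"
    and M: "in_M \<mu> \<theta> S \<epsilon> m" and \<epsilon>: "0 < \<epsilon>" "\<epsilon> < 1" and c: "1 \<le> c"
  obtains K where "0 < K"
    "\<And>x r. \<lbrakk>0 < r; r \<le> 1; cball x (c * r) \<inter> S \<noteq> {}\<rbrakk> \<Longrightarrow>
      emeasure \<mu> (cball x (T * r)) \<le>
        ennreal (K * r powr \<theta>) * emeasure (m (nat (kidx \<epsilon> r))) (cball x (2 * (c * r)))"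
proof -
  obtain K where K: "0 < K" and low: "\<And>z r. \<lbrakk>z \<in> S; 0 < r; r \<le> 1\<rbrakk> \<Longrightarrow>
      emeasure \<mu> (cball z r) \<le> ennreal (K * r powr \<theta>) * emeasure (m (nat (kidx \<epsilon> r))) (cball z r)"
    using in_M_lower[OF M \<epsilon>] by blast
  obtain D where D: "0 < D" and doubling: "\<And>z r. \<lbrakk>0 < r; r \<le> 1\<rbrakk> \<Longrightarrow>
      emeasure \<mu> (cball z ((T + c) * r)) \<le> ennreal D * emeasure \<mu> (cball z r)"
    using doubling_cball[OF \<mu>, of "T + c"] by blast
  have sets: "sets \<mu> = sets borel" using \<mu> by (simp add: mm_space_def)
  show ?thesis
  proof
    show "0 < D * K" using D K by simp
    fix x and r :: real assume r: "0 < r" "r \<le> 1" and "cball x (c * r) \<inter> S \<noteq> {}"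
    then obtain z where z: "z \<in> S" "dist x z \<le> c * r" by auto
    let ?m = "m (nat (kidx \<epsilon> r))"
    have "cball x (T * r) \<subseteq> cball z ((T + c) * r)"
      using z by (intro cball_subset_cballI) (simp add: algebra_simps dist_commute)
    then have "emeasure \<mu> (cball x (T * r)) \<le> emeasure \<mu> (cball z ((T + c) * r))"
      by (intro emeasure_mono) (auto simp: sets)
    also have "\<dots> \<le> ennreal D * emeasure \<mu> (cball z r)" by (rule doubling[OF r])
    also have "\<dots> \<le> ennreal D * (ennreal (K * r powr \<theta>) * emeasure ?m (cball z r))"
      by (intro mult_left_mono low z r) simp
    also have "\<dots> \<le> ennreal D * (ennreal (K * r powr \<theta>) * emeasure ?m (cball x (2 * (c * r))))"
    proof (intro mult_left_mono emeasure_mono)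
      have "r \<le> c * r" using c r by simp
      then show "cball z r \<subseteq> cball x (2 * (c * r))"
        using z by (intro cball_subset_cballI) linarith
    qed (auto simp: in_M_sets[OF M])
    also have "\<dots> = ennreal (D * K * r powr \<theta>) * emeasure ?m (cball x (2 * (c * r)))"
      using D K by (subst ennreal_cmult_cmult) (auto simp: mult_ac)
    finally show "emeasure \<mu> (cball x (T * r)) \<le>
        ennreal (D * K * r powr \<theta>) * emeasure ?m (cball x (2 * (c * r)))" .
  qed
qed

text \<open>The oscillation over \<open>B\<^bsub>2cr\<^esub>(x)\<close> is compared with the one over the larger ball of radius
  \<open>2(c + 1)r\<close> around any \<open>y \<in> B\<^bsub>r\<^esub>(x)\<close>. The restriction on \<open>r\<close> keeps that radius below 1,
  where the upper bound on the measures is available.\<close>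
lemma osc_le_sharp:
  assumes \<mu>: "unif_loc_doubling \<mu>" "mm_space \<mu>" and M: "in_M \<mu> \<theta> S \<epsilon> m"
    and \<epsilon>: "0 < \<epsilon>" "\<epsilon> \<le> 1/10" and \<theta>: "0 \<le> \<theta>" and c: "1 \<le> c"
  obtains K where "0 < K"
    "\<And>f x y r. \<lbrakk>f \<in> borel_measurable borel; 0 < r; r \<le> 1/(4*c);
        cball x (c * r) \<inter> S \<noteq> {}; y \<in> cball x r\<rbrakk> \<Longrightarrow>
      osc (m (nat (kidx \<epsilon> r))) f (cball x (2 * (c * r))) \<le> ennreal (K * r) * sharp \<epsilon> m f y"
proof -
  have \<epsilon>1: "\<epsilon> < 1" using \<epsilon> by simp
  obtain C where C: "0 < C" and le: "\<And>k j g. g \<in> borel_measurable borel \<Longrightarrow>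
      (\<integral>\<^sup>+ y. g y \<partial>m (k + j)) \<le> ennreal (C / \<epsilon> powr (\<theta> * real j)) * (\<integral>\<^sup>+ y. g y \<partial>m k)"
    using in_M_nn_integral_le[OF M \<epsilon>(1)] by blast
  obtain U where U: "0 < U" and up: "\<And>x r. \<lbrakk>0 < r; 2 * r \<le> 1\<rbrakk> \<Longrightarrow>
      emeasure (m (nat (kidx \<epsilon> r))) (cball x (2*r)) \<le> ennreal (U / r powr \<theta>) * emeasure \<mu> (cball x (2*r))"
    using in_M_upper[OF M \<epsilon> \<theta>] by blast
  \<comment> \<open>2c + 3 = 2(c + 1) + 1: the ball of radius 2(c + 1)r around y lies in the one of
    radius (2c + 3)r around x.\<close>
  obtain L where L: "0 < L" and low: "\<And>x r. \<lbrakk>0 < r; r \<le> 1; cball x (c * r) \<inter> S \<noteq> {}\<rbrakk> \<Longrightarrow>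
      emeasure \<mu> (cball x ((2 * c + 3) * r)) \<le>
        ennreal (L * r powr \<theta>) * emeasure (m (nat (kidx \<epsilon> r))) (cball x (2 * (c * r)))"
    using in_M_lower_near[OF \<mu> M \<epsilon>(1) \<epsilon>1 c] by blast
  define A where "A = C / (\<epsilon> / (c + 1)) powr \<theta>"
  define B where "B = U * L"
  have A: "0 < A" and B: "0 < B" using C \<epsilon> c U L by (auto simp: A_def B_def)
  show ?thesis
  proof
    show "0 < A * B * (c + 1)" using A B c by simp
    fix f :: "'a \<Rightarrow> real" and x y :: 'a and r :: real
    assume f: "f \<in> borel_measurable borel" and r: "0 < r" "r \<le> 1/(4*c)"
      and S: "cball x (c * r) \<inter> S \<noteq> {}" and y: "y \<in> cball x r"
    define R where "R = (c + 1) * r"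
    have cr: "c * r \<le> 1/4" using r c by (simp add: field_simps)
    have rc: "r \<le> c * r" using r c by simp
    have R: "0 < R" "2 * R \<le> 1" "r \<le> R" "r \<le> 1"
    proof -
      have "R = c * r + r" by (simp add: R_def algebra_simps)
      then show "0 < R" "2 * R \<le> 1" "r \<le> R" "r \<le> 1" using cr rc r by linarith+
    qed
    let ?k = "nat (kidx \<epsilon> R)" and ?l = "nat (kidx \<epsilon> r)"
    have k: "R \<le> \<epsilon> ^ ?k" "\<epsilon> ^ Suc ?k < R" and l: "r \<le> \<epsilon> ^ ?l" "\<epsilon> ^ Suc ?l < r"
      using kidx_props[OF \<epsilon>(1) \<epsilon>1, of R] kidx_props[OF \<epsilon>(1) \<epsilon>1, of r] r R by auto
    \<comment> \<open>The larger radius has the smaller index, which is the direction in which the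
      measures are comparable.\<close>
    have "\<epsilon> ^ Suc ?l < \<epsilon> ^ ?k" using k l R by linarith
    then have "?k < Suc ?l" by (rule power_strict_decreasing_iff[OF \<epsilon>(1) \<epsilon>1, THEN iffD1])
    then have "?k \<le> ?l" by simp
    then obtain j where j: "?l = ?k + j" using le_Suc_ex by blast
    \<comment> \<open>R / r = c + 1 is fixed, so the index gap j is bounded through \<epsilon>^j >
      \<epsilon>/(c + 1). This is where \<open>A\<close> comes from.\<close>
    have "\<epsilon> * \<epsilon> ^ ?k < (c + 1) * (\<epsilon> ^ ?k * \<epsilon> ^ j)"
    proof -
      have "\<epsilon> * \<epsilon> ^ ?k < (c + 1) * r" using k by (simp add: R_def)
      also have "\<dots> \<le> (c + 1) * \<epsilon> ^ ?l" using l c by simp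
      finally show ?thesis by (simp add: j power_add)
    qed
    then have "\<epsilon> ^ ?k * \<epsilon> < \<epsilon> ^ ?k * ((c + 1) * \<epsilon> ^ j)" by (simp add: mult_ac)
    then have "\<epsilon> < (c + 1) * \<epsilon> ^ j" by (rule mult_left_less_imp_less) (use \<epsilon> in simp)
    then have "\<epsilon> / (c + 1) \<le> \<epsilon> ^ j" using c by (simp add: divide_le_eq mult.commute)
    then have "(\<epsilon> / (c + 1)) powr \<theta> \<le> (\<epsilon> ^ j) powr \<theta>" using \<epsilon> c \<theta> by (intro powr_mono2) auto
    also have "\<dots> = \<epsilon> powr (\<theta> * real j)"
      using \<epsilon> by (simp add: powr_powr mult.commute flip: powr_realpow)
    finally have CA: "C / \<epsilon> powr (\<theta> * real j) \<le> A"
      unfolding A_def using C \<epsilon> c by (intro divide_left_mono) auto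
    have int: "(\<integral>\<^sup>+ y. g y \<partial>m ?l) \<le> ennreal A * (\<integral>\<^sup>+ y. g y \<partial>m ?k)" if "g \<in> borel_measurable borel" for g
    proof -
      have "(\<integral>\<^sup>+ y. g y \<partial>m ?l) \<le> ennreal (C / \<epsilon> powr (\<theta> * real j)) * (\<integral>\<^sup>+ y. g y \<partial>m ?k)"
        unfolding j by (rule le[OF that])
      also have "\<dots> \<le> ennreal A * (\<integral>\<^sup>+ y. g y \<partial>m ?k)"
        by (intro mult_right_mono ennreal_leI CA) simp
      finally show ?thesis .
    qed
    have meas: "borel_measurable (m i) = borel_measurable borel" for i
      by (rule measurable_cong_sets[OF in_M_sets[OF M] refl])
    have sets_\<mu>: "sets \<mu> = sets borel" using \<mu> by (simp add: mm_space_def)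
    have "emeasure (m ?k) (cball y (2 * R)) \<le> ennreal (U / R powr \<theta>) * emeasure \<mu> (cball y (2 * R))"
      by (rule up[OF R(1,2)])
    also have "\<dots> \<le> ennreal (U / R powr \<theta>) * emeasure \<mu> (cball x ((2 * c + 3) * r))"
      using y by (intro mult_left_mono emeasure_mono cball_subset_cballI)
        (auto simp: sets_\<mu> R_def algebra_simps)
    also have "\<dots> \<le> ennreal (U / R powr \<theta>) * (ennreal (L * r powr \<theta>) * emeasure (m ?l) (cball x (2 * (c * r))))"
      using r R S by (intro mult_left_mono low) auto
    also have "\<dots> = ennreal (U / R powr \<theta> * (L * r powr \<theta>)) * emeasure (m ?l) (cball x (2 * (c * r)))"
      using U L by (intro ennreal_cmult_cmult) auto
    also have "\<dots> \<le> ennreal B * emeasure (m ?l) (cball x (2 * (c * r)))"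
    proof (intro mult_right_mono ennreal_leI)
      \<comment> \<open>The powers of the radius from the upper and lower bounds cancel here, which
        makes \<open>B\<close> independent of r.\<close>
      have "r powr \<theta> \<le> R powr \<theta>" using r R \<theta> by (intro powr_mono2) auto
      then have "r powr \<theta> / R powr \<theta> \<le> 1" using R by simp
      then have "B * (r powr \<theta> / R powr \<theta>) \<le> B" using B by (intro mult_left_le) auto
      then show "U / R powr \<theta> * (L * r powr \<theta>) \<le> B" by (simp add: B_def)
    qed simp
    finally have ball: "emeasure (m ?k) (cball y (2 * R)) \<le> ennreal B * emeasure (m ?l) (cball x (2 * (c * r)))" .
    have "osc (m ?l) f (cball x (2 * (c * r))) \<le> ennreal (A * B) * osc (m ?k) f (cball y (2 * R))"
    proof (rule osc_mono_measure[OF _ _ _ _ ball A B])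
      have "dist y x + 2 * (c * r) \<le> 2 * R" using y r by (simp add: R_def algebra_simps dist_commute)
      then show "cball x (2 * (c * r)) \<subseteq> cball y (2 * R)" by (rule cball_subset_cballI)
    qed (use f int in \<open>simp_all add: meas in_M_sets[OF M]\<close>)
    also have "osc (m ?k) f (cball y (2 * R)) = osc_t (m ?k) f y R"
    proof -
      have "dist y x + c * r \<le> R" using y by (simp add: R_def algebra_simps dist_commute)
      then have "cball x (c * r) \<subseteq> cball y R" by (rule cball_subset_cballI)
      then show ?thesis using S by (auto simp: osc_t_def in_M_msupp[OF M])
    qed
    also have "osc_t (m ?k) f y R = ennreal R * (osc_t (m ?k) f y R / ennreal R)"
      using R by (simp add: ennreal_times_divide ennreal_mult_divide_eq mult.commute[of "ennreal R"])
    also have "ennreal (A * B) * (ennreal R * (osc_t (m ?k) f y R / ennreal R))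
        \<le> ennreal (A * B) * (ennreal R * sharp \<epsilon> m f y)"
      unfolding sharp_def using R by (intro mult_left_mono SUP_upper) auto
    also have "ennreal (A * B) * (ennreal R * sharp \<epsilon> m f y) = ennreal (A * B * (c + 1) * r) * sharp \<epsilon> m f y"
      using A B R by (subst ennreal_cmult_cmult) (auto simp: R_def mult_ac)
    finally show "osc (m ?l) f (cball x (2 * (c * r))) \<le> ennreal (A * B * (c + 1) * r) * sharp \<epsilon> m f y" .
  qed
qed

section \<open>Small balls: integrating the pointwise bound\<close>

lemma sum_disjoint_indicator_le:
  fixes h :: ennreal
  assumes "finite B" and disj: "\<And>q q'. \<lbrakk>q \<in> B; q' \<in> B; q \<noteq> q'\<rbrakk> \<Longrightarrow> H q \<inter> H q' = {}"
    and le: "\<And>q. \<lbrakk>q \<in> B; y \<in> H q\<rbrakk> \<Longrightarrow> a q \<le> h"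
  shows "(\<Sum>q\<in>B. a q * indicator (H q) y) \<le> h"
proof (cases "\<exists>q\<in>B. y \<in> H q")
  case True
  then obtain q where q: "q \<in> B" "y \<in> H q" by blast
  have "(\<Sum>q'\<in>B. a q' * indicator (H q') y) = (\<Sum>q'\<in>{q}. a q' * indicator (H q') y)"
    using assms(1) q disj by (intro sum.mono_neutral_right) (auto split: split_indicator)
  then show ?thesis using le q by simp
qed (simp add: indicator_def)

text \<open>The root 1/p is left out so that the sum is additive in the family and can be split by
  radius.\<close>

definition besov_sum :: "'a::metric_space measure \<Rightarrow> real \<Rightarrow> (nat \<Rightarrow> 'a measure) \<Rightarrow> real \<Rightarrow> real \<Rightarrow>
    ('a \<Rightarrow> real) \<Rightarrow> ('a \<times> real) set \<Rightarrow> ennreal" where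
  "besov_sum \<mu> \<epsilon> m p c f \<B> = (\<Sum>(x,r)\<in>\<B>. emeasure \<mu> (cball x r) / ennreal (r powr p) *
      enn_powr (osc_t (m (nat (kidx \<epsilon> r))) f x (c*r)) p)"

lemma besov_sum_small_le:
  assumes \<mu>: "unif_loc_doubling \<mu>" "mm_space \<mu>" and M: "in_M \<mu> \<theta> S \<epsilon> m"
    and \<epsilon>: "0 < \<epsilon>" "\<epsilon> \<le> 1/10" and \<theta>: "0 \<le> \<theta>" and c: "1 \<le> c" and p: "1 < p"
  obtains K where "0 < K"
    "\<And>f \<delta> \<B>. \<lbrakk>f \<in> borel_measurable borel; \<delta> \<le> 1/(4*c); nice S c \<delta> \<B>\<rbrakk> \<Longrightarrow>
      besov_sum \<mu> \<epsilon> m p c f \<B> \<le>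
        ennreal K * (\<integral>\<^sup>+ y\<in>Unbhd ((c+1)*\<delta>) S. enn_powr (sharp \<epsilon> m f y) p \<partial>\<mu>)"
proof -
  obtain K where K: "0 < K" and osc_le: "\<And>f x y r. \<lbrakk>f \<in> borel_measurable borel; 0 < r; r \<le> 1/(4*c);
        cball x (c * r) \<inter> S \<noteq> {}; y \<in> cball x r\<rbrakk> \<Longrightarrow>
      osc (m (nat (kidx \<epsilon> r))) f (cball x (2 * (c * r))) \<le> ennreal (K * r) * sharp \<epsilon> m f y"
    using osc_le_sharp[OF \<mu> M \<epsilon> \<theta> c] by blast
  obtain D where D: "0 < D" and doubling: "\<And>z r. \<lbrakk>0 < r; r \<le> 1\<rbrakk> \<Longrightarrow>
      emeasure \<mu> (cball z (2 * r)) \<le> ennreal D * emeasure \<mu> (cball z r)"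
    using doubling_cball[OF \<mu>, of 2] by blast
  have sets_\<mu>: "sets \<mu> = sets borel" using \<mu> by (simp add: mm_space_def)
  show ?thesis
  proof
    show "0 < K powr p * D" using K D by simp
    fix f :: "'a \<Rightarrow> real" and \<delta> \<B>
    assume f: "f \<in> borel_measurable borel" and \<delta>: "\<delta> \<le> 1/(4*c)" and nice: "nice S c \<delta> \<B>"
    have fin: "finite \<B>" using nice by (simp add: nice_def)
    have ball: "0 < r" "r \<le> \<delta>" "cball x (c*r) \<inter> S \<noteq> {}" if "(x,r) \<in> \<B>" for x r
      using nice that by (auto simp: nice_def)
    have disj: "cball x r \<inter> cball x' r' = {}"
      if "(x,r) \<in> \<B>" "(x',r') \<in> \<B>" "(x,r) \<noteq> (x',r')" for x r x' r'
      using nice that unfolding nice_def by blast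
    \<comment> \<open>Q is the oscillation normalised to lie below \<open>sharp\<close> on the whole
      ball, so that it can be integrated there as a constant.\<close>
    define Q where "Q = (\<lambda>(x,r). ennreal (1 / (K * r)) * osc (m (nat (kidx \<epsilon> r))) f (cball x (2 * (c * r))))"
    define a where "a = (\<lambda>q. enn_powr (Q q) p)"
    \<comment> \<open>Half balls, because a point of \<open>cball x r\<close> may lie at distance exactly \<open>(c + 1)\<delta>\<close> from \<open>S\<close>.\<close>
    define H where "H = (\<lambda>(x::'a,r::real). cball x (r/2))"
    have Q_le: "Q (x,r) \<le> sharp \<epsilon> m f y" if "(x,r) \<in> \<B>" "y \<in> cball x r" for x r y
    proof -
      have r: "0 < r" "r \<le> 1/(4*c)" using ball[OF that(1)] \<delta> by auto
      have "Q (x,r) \<le> ennreal (1 / (K * r)) * (ennreal (K * r) * sharp \<epsilon> m f y)"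
        unfolding Q_def prod.case
        by (intro mult_left_mono osc_le f r ball(3)[OF that(1)] that(2)) simp
      also have "\<dots> = sharp \<epsilon> m f y"
        using K r by (subst ennreal_cmult_cmult) auto
      finally show ?thesis .
    qed
    have H_sets: "H q \<in> sets \<mu>" for q
      by (simp add: H_def sets_\<mu> split: prod.split)
    have H_sub: "H (x,r) \<subseteq> cball x r \<inter> Unbhd ((c+1)*\<delta>) S" if q: "(x,r) \<in> \<B>" for x r
    proof
      fix y assume "y \<in> H (x,r)"
      then have y: "dist x y \<le> r/2" by (simp add: H_def)
      obtain z where z: "z \<in> S" "dist x z \<le> c * r" using ball(3)[OF q] by auto
      have "infdist y S \<le> dist y z" using z by (intro infdist_le)
      also have "\<dots> \<le> r/2 + c * r" using dist_triangle[of y z x] y z by (simp add: dist_commute)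
      also have "\<dots> < (c + 1) * r" using ball(1)[OF q] by (simp add: algebra_simps)
      also have "\<dots> \<le> (c + 1) * \<delta>" using ball(2)[OF q] c by simp
      finally show "y \<in> cball x r \<inter> Unbhd ((c+1)*\<delta>) S"
        using y ball(1)[OF q] by (simp add: Unbhd_def)
    qed
    have term_le: "emeasure \<mu> (cball x r) / ennreal (r powr p) * enn_powr (osc_t (m (nat (kidx \<epsilon> r))) f x (c*r)) p
        \<le> ennreal (K powr p * D) * (a (x,r) * emeasure \<mu> (H (x,r)))" if q: "(x,r) \<in> \<B>" for x r
    proof -
      have r: "0 < r" "r \<le> 1"
      proof -
        have "1/(4*c) \<le> 1" using c by (simp add: field_simps)
        then show "r \<le> 1" using ball(2)[OF q] \<delta> by linarith
      qed (rule ball(1)[OF q])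
      have "osc_t (m (nat (kidx \<epsilon> r))) f x (c*r) = osc (m (nat (kidx \<epsilon> r))) f (cball x (2 * (c * r)))"
        using ball(3)[OF q] by (simp add: osc_t_def in_M_msupp[OF M])
      also have "\<dots> = ennreal (K * r) * Q (x,r)"
        using K r by (simp add: Q_def ennreal_cmult_cmult)
      finally have "enn_powr (osc_t (m (nat (kidx \<epsilon> r))) f x (c*r)) p = ennreal ((K * r) powr p) * a (x,r)"
        using K r by (simp add: enn_powr_cmult a_def)
      also have "emeasure \<mu> (cball x r) / ennreal (r powr p) * \<dots>
          = ennreal (1 / r powr p) * (ennreal ((K * r) powr p) * (a (x,r) * emeasure \<mu> (cball x r)))"
        using ennreal_cmult_divide[of 1 "r powr p" "emeasure \<mu> (cball x r)"] r by (simp add: mult_ac)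
      also have "\<dots> = ennreal (K powr p) * (a (x,r) * emeasure \<mu> (cball x r))"
        using K r by (subst ennreal_cmult_cmult) (auto simp: powr_mult)
      also have "\<dots> \<le> ennreal (K powr p) * (a (x,r) * (ennreal D * emeasure \<mu> (H (x,r))))"
        using doubling[of "r/2" x] r by (intro mult_left_mono) (simp_all add: H_def)
      also have "ennreal (K powr p) * (a (x,r) * (ennreal D * emeasure \<mu> (H (x,r)))) =
          ennreal (K powr p * D) * (a (x,r) * emeasure \<mu> (H (x,r)))"
        using D by (simp add: ennreal_mult mult_ac)
      finally show ?thesis .
    qed
    have "besov_sum \<mu> \<epsilon> m p c f \<B> \<le> (\<Sum>q\<in>\<B>. ennreal (K powr p * D) * (a q * emeasure \<mu> (H q)))"
      unfolding besov_sum_def using term_le by (intro sum_mono) (auto simp: case_prod_beta)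
    also have "\<dots> = ennreal (K powr p * D) * (\<integral>\<^sup>+ y. (\<Sum>q\<in>\<B>. a q * indicator (H q) y) \<partial>\<mu>)"
      using H_sets by (subst nn_integral_sum) (auto simp: sum_distrib_left nn_integral_cmult_indicator)
    also have "\<dots> \<le> ennreal (K powr p * D) * (\<integral>\<^sup>+ y\<in>Unbhd ((c+1)*\<delta>) S. enn_powr (sharp \<epsilon> m f y) p \<partial>\<mu>)"
    proof (intro mult_left_mono nn_integral_mono sum_disjoint_indicator_le fin)
      fix y q q'
      show "H q \<inter> H q' = {}" if "q \<in> \<B>" "q' \<in> \<B>" "q \<noteq> q'"
        using that H_sub[of "fst q" "snd q"] H_sub[of "fst q'" "snd q'"] disj[of "fst q" "snd q" "fst q'" "snd q'"]
        by auto
      show "a q \<le> enn_powr (sharp \<epsilon> m f y) p * indicator (Unbhd ((c+1)*\<delta>) S) y" if "q \<in> \<B>" "y \<in> H q"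
      proof -
        have "y \<in> cball (fst q) (snd q)" "y \<in> Unbhd ((c+1)*\<delta>) S"
          using that H_sub[of "fst q" "snd q"] by auto
        then show ?thesis
          using Q_le[of "fst q" "snd q" y] that p by (simp add: a_def enn_powr_mono)
      qed
    qed simp
    finally show "besov_sum \<mu> \<epsilon> m p c f \<B> \<le>
        ennreal (K powr p * D) * (\<integral>\<^sup>+ y\<in>Unbhd ((c+1)*\<delta>) S. enn_powr (sharp \<epsilon> m f y) p \<partial>\<mu>)" .
  qed
qed

section \<open>Large balls: bounded overlap\<close>

text \<open>A packing argument. Shrunk to the common radius \<rho>, the balls stay disjoint and lie
  in the ball of radius s + 1 around y; by doubling each carries at least the fraction 1/D of its
  mass, so there are at most D of them.\<close>

lemma card_balls_near_le:
  fixes \<mu> :: "'a::polish_space measure"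
  assumes \<mu>: "unif_loc_doubling \<mu>" "mm_space \<mu>" and \<rho>: "0 < \<rho>" "\<rho> \<le> 1" and s: "0 \<le> s"
  obtains N where "0 < N"
    "\<And>(y::'a) \<B>. \<lbrakk>finite \<B>; \<forall>q\<in>\<B>. \<rho> \<le> snd q \<and> dist (fst q) y \<le> s;
        pairwise (\<lambda>q q'. disjnt (cball (fst q) (snd q)) (cball (fst q') (snd q'))) \<B>\<rbrakk> \<Longrightarrow>
      real (card \<B>) \<le> N"
proof -
  \<comment> \<open>The dilation takes \<rho> to 2s + 1, enough for a centre within s of y to reach
    the whole ball of radius s + 1.\<close>
  obtain D where D: "0 < D" and doubling: "\<And>z r. \<lbrakk>0 < r; r \<le> 1\<rbrakk> \<Longrightarrow>
      emeasure \<mu> (cball z ((2 * s + 1) / \<rho> * r)) \<le> ennreal D * emeasure \<mu> (cball z r)"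
    using doubling_cball[OF \<mu>, of "(2 * s + 1) / \<rho>"] by blast
  have sets_\<mu>: "sets \<mu> = sets borel" using \<mu> by (simp add: mm_space_def)
  show ?thesis
  proof
    show "0 < D" by fact
    fix y :: 'a and \<B>
    assume fin: "finite \<B>" and near: "\<forall>q\<in>\<B>. \<rho> \<le> snd q \<and> dist (fst q) y \<le> s"
      and disj: "pairwise (\<lambda>q q'. disjnt (cball (fst q) (snd q)) (cball (fst q') (snd q'))) \<B>"
    let ?G = "cball y (s + 1)"
    have pos: "0 < emeasure \<mu> ?G" "emeasure \<mu> ?G < \<infinity>"
      using \<mu>(2) s by (auto simp: mm_space_def)
    then obtain M where M: "emeasure \<mu> ?G = ennreal M" "0 < M"
      by (cases "emeasure \<mu> ?G") auto
    have "of_nat (card \<B>) * emeasure \<mu> ?G = (\<Sum>q\<in>\<B>. emeasure \<mu> ?G)" by simp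
    also have "\<dots> \<le> (\<Sum>q\<in>\<B>. ennreal D * emeasure \<mu> (cball (fst q) \<rho>))"
    proof (rule sum_mono)
      fix q assume "q \<in> \<B>"
      then have "dist (fst q) y + (s + 1) \<le> (2 * s + 1) / \<rho> * \<rho>"
        using near \<rho> by auto
      then have "emeasure \<mu> ?G \<le> emeasure \<mu> (cball (fst q) ((2 * s + 1) / \<rho> * \<rho>))"
        by (intro emeasure_mono cball_subset_cballI) (auto simp: sets_\<mu>)
      then show "emeasure \<mu> ?G \<le> ennreal D * emeasure \<mu> (cball (fst q) \<rho>)"
        using doubling[OF \<rho>, of "fst q"] by (rule order_trans)
    qed
    also have "\<dots> = ennreal D * (\<Sum>q\<in>\<B>. emeasure \<mu> (cball (fst q) \<rho>))"
      by (simp add: sum_distrib_left)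
    also have "(\<Sum>q\<in>\<B>. emeasure \<mu> (cball (fst q) \<rho>)) = emeasure \<mu> (\<Union>q\<in>\<B>. cball (fst q) \<rho>)"
    proof (rule sum_emeasure[OF _ _ fin])
      show "disjoint_family_on (\<lambda>q. cball (fst q) \<rho>) \<B>"
        unfolding disjoint_family_on_def
      proof (intro ballI impI)
        fix q q' assume q: "q \<in> \<B>" "q' \<in> \<B>" "q \<noteq> q'"
        then have "cball (fst q) \<rho> \<subseteq> cball (fst q) (snd q)" "cball (fst q') \<rho> \<subseteq> cball (fst q') (snd q')"
          using near q by (auto intro!: subset_cball)
        then show "cball (fst q) \<rho> \<inter> cball (fst q') \<rho> = {}" using pairwiseD[OF disj q] unfolding disjnt_def by blast
      qed
    qed (auto simp: sets_\<mu>)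
    also have "ennreal D * \<dots> \<le> ennreal D * emeasure \<mu> ?G"
    proof (intro mult_left_mono emeasure_mono UN_least cball_subset_cballI)
      show "dist y (fst q) + \<rho> \<le> s + 1" if "q \<in> \<B>" for q
        using near that \<rho> by (auto simp: dist_commute intro!: add_mono)
    qed (auto simp: sets_\<mu>)
    finally have "ennreal (real (card \<B>) * M) \<le> ennreal (D * M)"
      using M D by (simp add: ennreal_mult ennreal_of_nat_eq_real_of_nat)
    then show "real (card \<B>) \<le> D" using M D by (simp add: ennreal_le_iff)
  qed
qed

text \<open>From \<rho> \<le> r \<le> \<epsilon>^k, the factor \<epsilon>^(-\<theta>k) relating
  \<open>m k\<close> to \<open>m 0\<close> is at most \<rho>^(-\<theta>). The mass \<mu>(B) absorbs
  the denominator of the moment average, and the enlarged balls overlap at most N times.\<close>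

lemma besov_sum_large_le:
  assumes \<mu>: "unif_loc_doubling \<mu>" "mm_space \<mu>" and M: "in_M \<mu> \<theta> S \<epsilon> m"
    and \<epsilon>: "0 < \<epsilon>" "\<epsilon> < 1" and \<theta>: "0 \<le> \<theta>" and c: "1 \<le> c" and p: "1 < p"
    and \<rho>: "0 < \<rho>" "\<rho> \<le> 1"
  obtains K where "0 < K"
    "\<And>f \<B>. \<lbrakk>f \<in> borel_measurable borel; nice S c 1 \<B>; \<And>x r. (x,r) \<in> \<B> \<Longrightarrow> \<rho> \<le> r\<rbrakk> \<Longrightarrow>
      besov_sum \<mu> \<epsilon> m p c f \<B> \<le> ennreal K * (\<integral>\<^sup>+ y. ennreal (\<bar>f y\<bar> powr p) \<partial>m 0)"
proof -
  obtain C where C: "0 < C" and le: "\<And>k j g. g \<in> borel_measurable borel \<Longrightarrow>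
      (\<integral>\<^sup>+ y. g y \<partial>m (k + j)) \<le> ennreal (C / \<epsilon> powr (\<theta> * real j)) * (\<integral>\<^sup>+ y. g y \<partial>m k)"
    using in_M_nn_integral_le[OF M \<epsilon>(1)] by blast
  obtain L where L: "0 < L" and low: "\<And>x r. \<lbrakk>0 < r; r \<le> 1; cball x (c * r) \<inter> S \<noteq> {}\<rbrakk> \<Longrightarrow>
      emeasure \<mu> (cball x (1 * r)) \<le>
        ennreal (L * r powr \<theta>) * emeasure (m (nat (kidx \<epsilon> r))) (cball x (2 * (c * r)))"
    using in_M_lower_near[OF \<mu> M \<epsilon> c] by blast
  have c2: "0 \<le> 2 * c" using c by simp
  obtain N where N: "0 < N" and card_le: "\<And>(y::'a) \<B>. \<lbrakk>finite \<B>; \<forall>q\<in>\<B>. \<rho> \<le> snd q \<and> dist (fst q) y \<le> 2 * c;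
        pairwise (\<lambda>q q'. disjnt (cball (fst q) (snd q)) (cball (fst q') (snd q'))) \<B>\<rbrakk> \<Longrightarrow>
      real (card \<B>) \<le> N"
    using card_balls_near_le[OF \<mu> \<rho> c2] by blast
  have sets: "sets (m k) = sets borel" for k by (rule in_M_sets[OF M])
  have meas: "borel_measurable (m k) = borel_measurable borel" for k
    by (rule measurable_cong_sets[OF sets refl])
  \<comment> \<open>The factors stem from r^(-p), the moment bound on the oscillation, the lower
    mass bound, and the passage from \<open>m k\<close> to \<open>m 0\<close>.\<close>
  define A where "A = 1 / \<rho> powr p * (2 powr p * (L * (C / \<rho> powr \<theta>)))"
  have A: "0 < A" using \<rho> L C by (simp add: A_def)
  show ?thesis
  proof
    show "0 < A * N" using A N by simp
    fix f :: "'a \<Rightarrow> real" and \<B>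
    assume f: "f \<in> borel_measurable borel" and nice: "nice S c 1 \<B>"
      and large: "\<And>x r. (x,r) \<in> \<B> \<Longrightarrow> \<rho> \<le> r"
    define F where "F = (\<lambda>y. ennreal (\<bar>f y\<bar> powr p))"
    have F: "F \<in> borel_measurable borel" using f by (simp add: F_def)
    have \<mu>_ball: "emeasure \<mu> (cball x r) \<noteq> 0 \<and> emeasure \<mu> (cball x r) < \<infinity>" if "0 < r" for x r
      using \<mu>(2) that unfolding mm_space_def by (metis less_irrefl)
    have F_ind: "(\<lambda>y. F y * indicator (cball x s) y) \<in> borel_measurable borel" for x s
      by (intro borel_measurable_times_ennreal F borel_measurable_indicator) simp
    have fin: "finite \<B>" using nice by (simp add: nice_def)
    have ball: "0 < r" "r \<le> 1" "cball x (c*r) \<inter> S \<noteq> {}" if "(x,r) \<in> \<B>" for x r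
      using nice that by (auto simp: nice_def)
    have disj: "cball x r \<inter> cball x' r' = {}"
      if "(x,r) \<in> \<B>" "(x',r') \<in> \<B>" "(x,r) \<noteq> (x',r')" for x r x' r'
      using nice that unfolding nice_def by blast
    have term_le: "emeasure \<mu> (cball x r) / ennreal (r powr p) * enn_powr (osc_t (m (nat (kidx \<epsilon> r))) f x (c*r)) p
        \<le> ennreal A * (\<integral>\<^sup>+ y. F y * indicator (cball x (2 * c)) y \<partial>m 0)" if q: "(x,r) \<in> \<B>" for x r
    proof -
      note r = ball[OF q]
      define k where "k = nat (kidx \<epsilon> r)"
      define G where "G = cball x (2 * (c * r))"
      define I where "I = (\<integral>\<^sup>+ y\<in>G. F y \<partial>m k)"
      have "r \<le> \<epsilon> ^ k" using kidx_props[OF \<epsilon> r(1,2)] by (simp add: k_def)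
      then have "\<rho> powr \<theta> \<le> (\<epsilon> ^ k) powr \<theta>" using \<rho> large[OF q] \<theta> by (intro powr_mono2) auto
      also have "\<dots> = \<epsilon> powr (\<theta> * real k)"
        using \<epsilon> by (simp add: powr_powr mult.commute flip: powr_realpow)
      finally have Ck: "C / \<epsilon> powr (\<theta> * real k) \<le> C / \<rho> powr \<theta>"
        using C \<rho> \<epsilon> by (intro divide_left_mono) auto
      have "I \<le> ennreal (C / \<epsilon> powr (\<theta> * real k)) * (\<integral>\<^sup>+ y\<in>G. F y \<partial>m 0)"
        unfolding I_def using le[OF F_ind[of x "2 * (c * r)"], of 0 k] by (simp add: G_def)
      also have "\<dots> \<le> ennreal (C / \<rho> powr \<theta>) * (\<integral>\<^sup>+ y\<in>cball x (2 * c). F y \<partial>m 0)"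
      proof (rule mult_mono[OF ennreal_leI[OF Ck] nn_integral_mono])
        \<comment> \<open>All domains are enlarged to the common radius 2c, so that overlap at a
          point only concerns the distance of the centres from it.\<close>
        have "2 * (c * r) \<le> 2 * c" using r c by simp
        then show "F y * indicator G y \<le> F y * indicator (cball x (2 * c)) y" for y
          by (auto simp: G_def split: split_indicator)
      qed auto
      finally have I_le: "I \<le> ennreal (C / \<rho> powr \<theta>) * (\<integral>\<^sup>+ y\<in>cball x (2 * c). F y \<partial>m 0)" .
      have mu_le: "emeasure \<mu> (cball x r) \<le> ennreal L * emeasure (m k) G"
      proof -
        have "r powr \<theta> \<le> 1" using r \<theta> by (simp add: powr_le1)
        then have "L * r powr \<theta> \<le> L" using L by (simp add: mult_left_le)
        then show ?thesis
          using low[OF r] by (simp add: k_def G_def) (meson ennreal_leI mult_right_mono order_trans zero_le)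
      qed
      have frac: "emeasure \<mu> (cball x r) * (I / emeasure (m k) G) \<le> ennreal L * I"
      proof -
        have "inverse (emeasure (m k) G) \<le> ennreal L * inverse (emeasure \<mu> (cball x r))"
          by (intro ennreal_inverse_le_cmult mu_le L)
        then have "emeasure \<mu> (cball x r) * (I * inverse (emeasure (m k) G))
            \<le> emeasure \<mu> (cball x r) * (I * (ennreal L * inverse (emeasure \<mu> (cball x r))))"
          by (intro mult_left_mono) auto
        also have "\<dots> = ennreal L * I * (emeasure \<mu> (cball x r) / emeasure \<mu> (cball x r))"
          by (simp add: divide_ennreal_def mult_ac)
        also have "emeasure \<mu> (cball x r) / emeasure \<mu> (cball x r) = 1"
          using \<mu>_ball[of r x] r(1) by (intro ennreal_divide_self) auto
        finally show ?thesis by (simp add: divide_ennreal_def)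
      qed
      have "osc_t (m (nat (kidx \<epsilon> r))) f x (c*r) = osc (m k) f G"
        using r(3) by (simp add: osc_t_def in_M_msupp[OF M] k_def G_def)
      then have "enn_powr (osc_t (m (nat (kidx \<epsilon> r))) f x (c*r)) p \<le> ennreal (2 powr p) * (I / emeasure (m k) G)"
        unfolding I_def F_def using f p by (simp add: osc_powr_le meas sets G_def)
      moreover have "emeasure \<mu> (cball x r) / ennreal (r powr p) \<le> ennreal (1 / \<rho> powr p) * emeasure \<mu> (cball x r)"
      proof -
        have "\<rho> powr p \<le> r powr p" using \<rho> large[OF q] p by (intro powr_mono2) auto
        then have "1 / r powr p \<le> 1 / \<rho> powr p" using \<rho> r(1) by (intro divide_left_mono) auto
        then have "ennreal (1 / r powr p) * emeasure \<mu> (cball x r) \<le> ennreal (1 / \<rho> powr p) * emeasure \<mu> (cball x r)"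
          by (intro mult_right_mono ennreal_leI) auto
        then show ?thesis
          using ennreal_cmult_divide[of 1 "r powr p" "emeasure \<mu> (cball x r)"] r by simp
      qed
      ultimately have "emeasure \<mu> (cball x r) / ennreal (r powr p) * enn_powr (osc_t (m (nat (kidx \<epsilon> r))) f x (c*r)) p
          \<le> (ennreal (1 / \<rho> powr p) * emeasure \<mu> (cball x r)) * (ennreal (2 powr p) * (I / emeasure (m k) G))"
        by (intro mult_mono) auto
      also have "\<dots> = ennreal (1 / \<rho> powr p) * (ennreal (2 powr p) * (emeasure \<mu> (cball x r) * (I / emeasure (m k) G)))"
        by (simp only: mult_ac)
      also have "\<dots> \<le> ennreal (1 / \<rho> powr p) * (ennreal (2 powr p) * (ennreal L *
          (ennreal (C / \<rho> powr \<theta>) * (\<integral>\<^sup>+ y\<in>cball x (2 * c). F y \<partial>m 0))))"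
        by (intro mult_left_mono order_trans[OF frac] I_le zero_le)
      also have "\<dots> = ennreal A * (\<integral>\<^sup>+ y\<in>cball x (2 * c). F y \<partial>m 0)"
        using L C \<rho> by (simp only: ennreal_cmult_cmult A_def zero_le_divide_iff powr_ge_zero zero_le_one
            mult_nonneg_nonneg less_imp_le simp_thms)
      finally show ?thesis .
    qed
    have "besov_sum \<mu> \<epsilon> m p c f \<B> \<le> (\<Sum>q\<in>\<B>. ennreal A * (\<integral>\<^sup>+ y. F y * indicator (cball (fst q) (2 * c)) y \<partial>m 0))"
      unfolding besov_sum_def using term_le by (intro sum_mono) (auto simp: case_prod_beta)
    also have "\<dots> = ennreal A * (\<integral>\<^sup>+ y. (\<Sum>q\<in>\<B>. F y * indicator (cball (fst q) (2 * c)) y) \<partial>m 0)"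
      using F_ind by (subst nn_integral_sum) (auto simp: sum_distrib_left meas)
    also have "\<dots> \<le> ennreal A * (\<integral>\<^sup>+ y. ennreal N * F y \<partial>m 0)"
    proof (intro mult_left_mono nn_integral_mono)
      fix y
      let ?B = "{q\<in>\<B>. y \<in> cball (fst q) (2 * c)}"
      have "(\<Sum>q\<in>\<B>. F y * indicator (cball (fst q) (2 * c)) y) = (\<Sum>q\<in>?B. F y)"
        using fin by (intro sum.mono_neutral_cong_right) auto
      also have "\<dots> = ennreal (real (card ?B)) * F y"
        by (simp add: ennreal_of_nat_eq_real_of_nat)
      also have "\<dots> \<le> ennreal N * F y"
      proof (intro mult_right_mono ennreal_leI card_le[of ?B y])
        show "pairwise (\<lambda>q q'. disjnt (cball (fst q) (snd q)) (cball (fst q') (snd q'))) ?B"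
          using disj by (auto simp: pairwise_def disjnt_def)
      qed (use fin large in auto)
      finally show "(\<Sum>q\<in>\<B>. F y * indicator (cball (fst q) (2 * c)) y) \<le> ennreal N * F y" .
    qed simp
    also have "\<dots> = ennreal (A * N) * (\<integral>\<^sup>+ y. F y \<partial>m 0)"
      using F A N by (simp add: nn_integral_cmult meas ennreal_cmult_cmult)
    finally show "besov_sum \<mu> \<epsilon> m p c f \<B> \<le> ennreal (A * N) * (\<integral>\<^sup>+ y. ennreal (\<bar>f y\<bar> powr p) \<partial>m 0)"
      by (simp add: F_def)
  qed
qed

section \<open>Splitting a family by radius and assembling the estimates\<close>

lemma nice_subset:
  assumes nice: "nice S c \<delta> \<B>" and sub: "\<B>' \<subseteq> \<B>" and le: "\<And>x r. (x,r) \<in> \<B>' \<Longrightarrow> r \<le> \<delta>'"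
  shows "nice S c \<delta>' \<B>'"
  unfolding nice_def
proof (intro conjI)
  show "finite \<B>'" using nice sub finite_subset by (auto simp: nice_def)
  have ball: "0 < r" "cball x (c*r) \<inter> S \<noteq> {}" if "(x,r) \<in> \<B>" for x r
    using nice that by (auto simp: nice_def)
  show "\<forall>(x,r)\<in>\<B>'. 0 < r \<and> r \<le> \<delta>' \<and> cball x (c*r) \<inter> S \<noteq> {}"
    by (intro ballI case_prodI2 conjI ball le) (use sub in auto)
  have disj: "cball x r \<inter> cball y s = {}" if "(x,r) \<in> \<B>" "(y,s) \<in> \<B>" "(x,r) \<noteq> (y,s)" for x r y s
    using nice that unfolding nice_def by blast
  show "\<forall>(x,r)\<in>\<B>'. \<forall>(y,s)\<in>\<B>'. (x,r) \<noteq> (y,s) \<longrightarrow> cball x r \<inter> cball y s = {}"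
    by (intro ballI case_prodI2 impI disj) (use sub in auto)
qed

lemma BSN_eq:
  "BSN \<mu> S \<epsilon> m \<delta> p c f =
    Lp_norm p (m 0) f + (SUP \<B>\<in>{\<B>. nice S c \<delta> \<B>}. enn_powr (besov_sum \<mu> \<epsilon> m p c f \<B>) (1/p))"
  by (simp add: BSN_def besov_sum_def)

text \<open>\<open>BSN\<close> is the norm of f plus a nonnegative term, so the absolute difference
  amounts to a one-sided bound. It is written additively to avoid \<infinity> - \<infinity>.\<close>

theorem mainTheorem14:
  fixes \<mu> :: "'a::polish_space measure" and m :: "nat \<Rightarrow> 'a measure"
    and S :: "'a set" and p \<theta> \<epsilon> c :: real
  assumes p: "1 < p"
    and X: "class_A p \<mu>"
    and \<theta>: "0 \<le> \<theta>" "\<theta> < p"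
    and S: "LCR \<mu> \<theta> S" "closed S"
    and \<epsilon>: "0 < \<epsilon>" "\<epsilon> \<le> 1/10"
    and M: "in_M \<mu> \<theta> S \<epsilon> m"
    and c: "1 \<le> c"
  shows "(\<exists>C>0. \<forall>f. (\<forall>k. loc_int (m k) f) \<longrightarrow>
            BSN \<mu> S \<epsilon> m 1 p c f \<le> ennreal C * CN p \<mu> \<epsilon> m f)
       \<and> (\<forall>\<delta>\<in>{0<..1/(4*c)}. \<exists>C\<delta>>0. \<forall>f. (\<forall>k. loc_int (m k) f) \<longrightarrow>
            BSN \<mu> S \<epsilon> m \<delta> p c f \<le> Lp_norm p (m 0) f
               + ennreal C\<delta> * Lp_norm_enn_on p \<mu> (Unbhd ((c+1)*\<delta>) S) (sharp \<epsilon> m f))"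
proof -
  have \<mu>: "unif_loc_doubling \<mu>" "mm_space \<mu>" using X by (auto simp: class_A_def)
  have \<epsilon>1: "\<epsilon> < 1" using \<epsilon> by simp
  define \<rho> where "\<rho> = 1 / (4 * c)"
  have \<rho>: "0 < \<rho>" "\<rho> \<le> 1" using c by (auto simp: \<rho>_def field_simps)
  obtain K where K: "0 < K" and small: "\<And>f \<delta> \<B>. \<lbrakk>f \<in> borel_measurable borel; \<delta> \<le> 1/(4*c); nice S c \<delta> \<B>\<rbrakk> \<Longrightarrow>
      besov_sum \<mu> \<epsilon> m p c f \<B> \<le>
        ennreal K * (\<integral>\<^sup>+ y\<in>Unbhd ((c+1)*\<delta>) S. enn_powr (sharp \<epsilon> m f y) p \<partial>\<mu>)"
    using besov_sum_small_le[OF \<mu> M \<epsilon> \<theta>(1) c p] by blast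
  obtain L where L: "0 < L" and large: "\<And>f \<B>. \<lbrakk>f \<in> borel_measurable borel; nice S c 1 \<B>; \<And>x r. (x,r) \<in> \<B> \<Longrightarrow> \<rho> \<le> r\<rbrakk> \<Longrightarrow>
      besov_sum \<mu> \<epsilon> m p c f \<B> \<le> ennreal L * (\<integral>\<^sup>+ y. ennreal (\<bar>f y\<bar> powr p) \<partial>m 0)"
    using besov_sum_large_le[OF \<mu> M \<epsilon>(1) \<epsilon>1 \<theta>(1) c p \<rho>] by blast
  have meas: "f \<in> borel_measurable borel" if "\<forall>k. loc_int (m k) f" for f
    using that loc_int_imp_borel_measurable[OF in_M_sets[OF M]] by blast
  have small': "enn_powr (besov_sum \<mu> \<epsilon> m p c f \<B>) (1/p) \<le>
      ennreal (K powr (1/p)) * Lp_norm_enn_on p \<mu> (Unbhd ((c+1)*\<delta>) S) (sharp \<epsilon> m f)"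
    if "f \<in> borel_measurable borel" "\<delta> \<le> 1/(4*c)" "nice S c \<delta> \<B>" for f \<delta> \<B>
    unfolding Lp_norm_enn_on_def enn_powr_cmult[OF K, symmetric]
    using small[OF that] p by (intro enn_powr_mono) auto
  \<comment> \<open>The summand 1 accounts for the norm of f inside \<open>BSN\<close>, the factor
    2^(1/p) for the root of a sum of two parts, and K and L for the small and the large
    balls.\<close>
  have "BSN \<mu> S \<epsilon> m 1 p c f \<le>
      ennreal (1 + 2 powr (1/p) * (K powr (1/p) + L powr (1/p))) * CN p \<mu> \<epsilon> m f"
    if "\<forall>k. loc_int (m k) f" for f
  proof -
    note f = meas[OF that]
    define V where "V = Lp_norm_enn_on p \<mu> UNIV (sharp \<epsilon> m f)"
    have "enn_powr (besov_sum \<mu> \<epsilon> m p c f \<B>) (1/p) \<le>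
        ennreal (2 powr (1/p) * (K powr (1/p) + L powr (1/p))) * CN p \<mu> \<epsilon> m f"
      if nice: "nice S c 1 \<B>" for \<B>
    proof -
      \<comment> \<open>The threshold \<rho> = 1/(4c) is the largest radius that the small-ball
        estimate admits.\<close>
      let ?Bs = "{q\<in>\<B>. snd q \<le> \<rho>}" and ?Bl = "{q\<in>\<B>. \<not> snd q \<le> \<rho>}"
      have fin: "finite \<B>" using nice by (simp add: nice_def)
      have "nice S c \<rho> ?Bs" "nice S c 1 ?Bl"
        by (rule nice_subset[OF nice]; use nice in \<open>auto simp: nice_def\<close>)+
      note s = small'[OF f _ this(1)] and l = large[OF f this(2)]
      have "enn_powr (besov_sum \<mu> \<epsilon> m p c f ?Bs) (1/p) \<le>
          ennreal (K powr (1/p)) * Lp_norm_enn_on p \<mu> (Unbhd ((c+1)*\<rho>) S) (sharp \<epsilon> m f)"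
        using s by (simp add: \<rho>_def)
      also have "\<dots> \<le> ennreal (K powr (1/p)) * V"
        unfolding Lp_norm_enn_on_def V_def using p
        by (intro mult_left_mono enn_powr_mono nn_integral_mono) (auto split: split_indicator)
      also have "\<dots> \<le> ennreal (K powr (1/p)) * CN p \<mu> \<epsilon> m f"
        by (intro mult_left_mono) (auto simp: CN_def V_def)
      finally have s: "enn_powr (besov_sum \<mu> \<epsilon> m p c f ?Bs) (1/p) \<le> ennreal (K powr (1/p)) * CN p \<mu> \<epsilon> m f" .
      have "enn_powr (besov_sum \<mu> \<epsilon> m p c f ?Bl) (1/p) \<le> ennreal (L powr (1/p)) * Lp_norm p (m 0) f"
        unfolding Lp_norm_def enn_powr_cmult[OF L, symmetric]
        using l p by (intro enn_powr_mono) auto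
      also have "\<dots> \<le> ennreal (L powr (1/p)) * CN p \<mu> \<epsilon> m f"
        by (intro mult_left_mono) (auto simp: CN_def)
      finally have l: "enn_powr (besov_sum \<mu> \<epsilon> m p c f ?Bl) (1/p) \<le> ennreal (L powr (1/p)) * CN p \<mu> \<epsilon> m f" .
      have "besov_sum \<mu> \<epsilon> m p c f \<B> = besov_sum \<mu> \<epsilon> m p c f ?Bs + besov_sum \<mu> \<epsilon> m p c f ?Bl"
        unfolding besov_sum_def using fin
        by (subst sum.union_disjoint[symmetric]) (auto intro!: sum.cong)
      then have "enn_powr (besov_sum \<mu> \<epsilon> m p c f \<B>) (1/p) \<le> ennreal (2 powr (1/p)) *
          (enn_powr (besov_sum \<mu> \<epsilon> m p c f ?Bs) (1/p) + enn_powr (besov_sum \<mu> \<epsilon> m p c f ?Bl) (1/p))"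
        using p by (simp add: enn_powr_add_le)
      also have "\<dots> \<le> ennreal (2 powr (1/p)) *
          (ennreal (K powr (1/p)) * CN p \<mu> \<epsilon> m f + ennreal (L powr (1/p)) * CN p \<mu> \<epsilon> m f)"
        by (intro mult_left_mono add_mono s l) simp
      also have "\<dots> = ennreal (2 powr (1/p) * (K powr (1/p) + L powr (1/p))) * CN p \<mu> \<epsilon> m f"
        by (simp add: ennreal_mult ennreal_plus distrib_right mult.assoc)
      finally show ?thesis .
    qed
    then have "BSN \<mu> S \<epsilon> m 1 p c f \<le> CN p \<mu> \<epsilon> m f +
        ennreal (2 powr (1/p) * (K powr (1/p) + L powr (1/p))) * CN p \<mu> \<epsilon> m f"
      unfolding BSN_eq by (intro add_mono SUP_least) (auto simp: CN_def)
    also have "\<dots> = ennreal (1 + 2 powr (1/p) * (K powr (1/p) + L powr (1/p))) * CN p \<mu> \<epsilon> m f"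
      by (subst ennreal_plus) (auto simp: distrib_right)
    finally show ?thesis .
  qed
  moreover have "BSN \<mu> S \<epsilon> m \<delta> p c f \<le> Lp_norm p (m 0) f
      + ennreal (K powr (1/p)) * Lp_norm_enn_on p \<mu> (Unbhd ((c+1)*\<delta>) S) (sharp \<epsilon> m f)"
    if "\<delta> \<in> {0<..1/(4*c)}" "\<forall>k. loc_int (m k) f" for \<delta> f
    unfolding BSN_eq using that small'[OF meas[OF that(2)]] by (intro add_mono SUP_least) auto
  moreover have "0 < 1 + 2 powr (1/p) * (K powr (1/p) + L powr (1/p))" "0 < K powr (1/p)"
    using K L by (auto intro!: add_pos_nonneg)
  ultimately show ?thesis by blast
qed

end
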